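(* For integers $T\ge1$ and $Q\ge0$ let $M^*_E(T,Q)$ and $M^*_N(T,Q)$ be the minimax numbers of mistakes of deterministic learners making at most $Q$ ERM calls, against adversarial oracles, under conventions E and N respectively. (i) $$\max\{T-Q,\lfloor\log_2(T+1)\rfloor\}\le M^*_E(T,Q)\le\max\{T-Q,\lceil T/2\rceil\}.$$ Under N, $M^*_N(T,0)=M^*_N(T,1)=T-1$, and for $Q\ge1$, $$\max\{T-Q,\lfloor\log_2T\rfloor\}\le M^*_N(T,Q)\le\min\big\{T-1,\ \max\{T-Q,\lceil T/2\rceil\}\big\}.$$ (ii) For $Q\le\lfloor T/2\rfloor$, $M^*_E(T,Q)=T-Q$. For $Q\ge2(T-1)$, $M^*_E(T,Q)=\lfloor\log_2(T+1)\rfloor$ and $M^*_N(T,Q)=\lfloor\log_2T\rfloor$ (this condition on $Q$ is sufficient, not necessary). (iii) The lower bound in (i) is not the exact value: $M^*_E(5,3)=3$ and $M^*_N(6,4)=3$.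
   Context: Domain and conventions. $T$ distinct instances are announced in advance as a sequence $x_1,\dots,x_T$. Convention E: $X=\{s,x_1,\dots,x_T\}$ and only total orders on $X$ in which the sentinel $s$ is the minimum are admissible. Convention N: $X=\{x_1,\dots,x_T\}$, all total orders on $X$ are admissible. For a total order $\preceq$ on $X$ and $z\in X$ let $c_z(x)=\mathbf 1[x\preceq z]$ and $C_\preceq=\{c_z:z\in X\}$. Oracle. A legal memoryless (consistency-type) ERM oracle for $\preceq$ is a function $O$ of the sample $S\subseteq X\times\{0,1\}$ such that $O(S)$ is a concept of $C_\preceq$ consistent with $S$ (given as a full label vector on $X$) if one exists, and $\bot$ otherwise. Protocol. The learner knows the convention, $X$, $T$ and the sequence, but not $\preceq$, $z$ or $O$. In round $t$ it predicts $\hat y_t\in\{0,1\}$ and then sees $y_t=c_z(x_t)$; at any time it may call the oracle on any adaptively chosen sample, each call costing one. The learner is deterministic: each action is a function of the history. Minimax value. $M^*_E(T,Q)$ (resp. $M^*_N(T,Q)$) is the minimum, over deterministic learners that make at most $Q$ oracle calls on every instance, of the maximum, over all admissible orders $\preceq$, targets $z\in X$ and legal memoryless ERM oracles $O$ for $\preceq$, of the number of mistakes, under convention E (resp. N). *)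

theory Defs
  imports Complex_Main
begin

text \<open>Total orders on \<open>X\<close> are relations \<open>r \<subseteq> X \<times> X\<close> with \<^term>\<open>linear_order_on X r\<close>;
  \<open>(x, z) \<in> r\<close> reads \<open>x \<preceq> z\<close>. Labels 1 and 0 are \<^term>\<open>True\<close> and \<^term>\<open>False\<close>.
  A concept, and hence an answer of the oracle, is a total function that is
  \<^term>\<open>False\<close> outside \<open>X\<close>, so it carries exactly the information of a label vector on \<open>X\<close>.\<close>

type_synonym 'a concept = "'a \<Rightarrow> bool"
type_synonym 'a sample = "('a \<times> bool) set"

definition threshold :: "'a rel \<Rightarrow> 'a \<Rightarrow> 'a concept" where
  "threshold r z = (\<lambda>x. (x, z) \<in> r)"

definition concept_class :: "'a set \<Rightarrow> 'a rel \<Rightarrow> 'a concept set" where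
  "concept_class X r = threshold r ` X"

definition consistent :: "'a concept \<Rightarrow> 'a sample \<Rightarrow> bool" where
  "consistent c S \<longleftrightarrow> (\<forall>(x, y) \<in> S. c x = y)"

text \<open>\<^term>\<open>None\<close> stands for \<open>\<bottom>\<close>. Being a function of the sample alone is memorylessness.\<close>

type_synonym 'a erm = "'a sample \<Rightarrow> 'a concept option"

definition legal_erm :: "'a set \<Rightarrow> 'a rel \<Rightarrow> 'a erm \<Rightarrow> bool" where
  "legal_erm X r A \<longleftrightarrow>
     (\<forall>S \<subseteq> X \<times> UNIV.
        if \<exists>c \<in> concept_class X r. consistent c S
        then \<exists>c \<in> concept_class X r. consistent c S \<and> A S = Some c
        else A S = None)"

text \<open>At each moment the learner either calls the oracle or predicts the label of the current
  instance, upon which the true label is revealed. The history records, oldest event first,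
  each call with its answer and each prediction with the true label.\<close>

datatype 'a action = Call "'a sample" | Predict bool

datatype 'a event =
    is_answer: Answer "'a sample" "'a concept option"
  | is_round: Round (predicted: bool) (revealed: bool)

type_synonym 'a history = "'a event list"
type_synonym 'a learner = "'a history \<Rightarrow> 'a action"

definition calls :: "'a history \<Rightarrow> nat" where
  "calls h = length (filter is_answer h)"

definition rounds :: "'a history \<Rightarrow> nat" where
  "rounds h = length (filter is_round h)"

definition mistakes :: "'a history \<Rightarrow> nat" where
  "mistakes h = length (filter (\<lambda>e. is_round e \<and> predicted e \<noteq> revealed e) h)"

fun respond :: "'a concept \<Rightarrow> 'a erm \<Rightarrow> 'a \<Rightarrow> 'a action \<Rightarrow> 'a event" where
  "respond c A x (Call S) = Answer S (A S)"
| "respond c A x (Predict b) = Round b (c x)"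

text \<open>\<open>play xs L c A n\<close> is the history after \<open>n\<close> actions of learner \<open>L\<close> against target concept
  \<open>c\<close> and oracle \<open>A\<close>; it stops changing once all instances of the sequence \<open>xs\<close> are labelled.\<close>

primrec play :: "'a list \<Rightarrow> 'a learner \<Rightarrow> 'a concept \<Rightarrow> 'a erm \<Rightarrow> nat \<Rightarrow> 'a history" where
  "play xs L c A 0 = []"
| "play xs L c A (Suc n) =
     (let h = play xs L c A n in
      if rounds h < length xs then h @ [respond c A (xs ! rounds h) (L h)] else h)"

text \<open>Below, \<open>R\<close> is the set of admissible orders on \<open>X\<close>.\<close>

definition instances :: "'a set \<Rightarrow> 'a rel set \<Rightarrow> ('a rel \<times> 'a \<times> 'a erm) set" where
  "instances X R = {(r, z, A). r \<in> R \<and> z \<in> X \<and> legal_erm X r A}"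

definition learners :: "'a set \<Rightarrow> 'a rel set \<Rightarrow> 'a list \<Rightarrow> nat \<Rightarrow> 'a learner set" where
  "learners X R xs Q =
     {L. (\<forall>h S. L h = Call S \<longrightarrow> S \<subseteq> X \<times> UNIV) \<and>
         (\<forall>(r, z, A) \<in> instances X R. \<forall>n. calls (play xs L (threshold r z) A n) \<le> Q)}"

text \<open>A learner making at most \<open>Q\<close> calls has predicted all labels after \<open>length xs + Q\<close>
  actions, so \<open>total_mistakes\<close> is evaluated at the final history. Its values are at most
  \<open>length xs\<close>; hence \<^const>\<open>Min\<close> and \<^const>\<open>Max\<close> below are applied to finite sets.\<close>

definition total_mistakes ::
    "'a list \<Rightarrow> nat \<Rightarrow> 'a learner \<Rightarrow> 'a rel \<times> 'a \<times> 'a erm \<Rightarrow> nat" where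
  "total_mistakes xs Q L = (\<lambda>(r, z, A). mistakes (play xs L (threshold r z) A (length xs + Q)))"

definition minimax :: "'a set \<Rightarrow> 'a rel set \<Rightarrow> 'a list \<Rightarrow> nat \<Rightarrow> nat" where
  "minimax X R xs Q =
     (MIN L \<in> learners X R xs Q. MAX i \<in> instances X R. total_mistakes xs Q L i)"

text \<open>The instance \<open>x\<^sub>t\<close> is represented by the number \<open>t\<close> and the sentinel by 0; the names
  of the elements carry no information, since only the relation \<open>r\<close> orders them.\<close>

definition M_E :: "nat \<Rightarrow> nat \<Rightarrow> nat" where
  "M_E T Q =
     minimax {0..T} {r. linear_order_on {0..T} r \<and> (\<forall>x \<in> {0..T}. (0, x) \<in> r)} [1..<Suc T] Q"

definition M_N :: "nat \<Rightarrow> nat \<Rightarrow> nat" where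
  "M_N T Q = minimax {1..T} {r. linear_order_on {1..T} r} [1..<Suc T] Q"

end

theory Submission
  imports Defs
begin

text \<open>Upper bounds. One call compares two consecutive instances, after which they cost at most one
  mistake together. Two calls asking for concepts that contain exactly one of two given elements
  yield a new initial segment of the order, so \<open>2 * (T - 1)\<close> calls sort the instances, and halving
  finishes.

  Lower bounds. The adversary keeps an order in which a set \<open>F\<close> of unlabelled elements is
  free between a bottom part (labels 1) and a top part (labels 0). A call that is not determined
  by the two parts has a negative example in \<open>F\<close>; moving it to the bottom makes \<open>\<bottom>\<close> a legal answer,
  so each call costs one free element, and each remaining free element costs a mistake. Revealing
  the order of \<open>F\<close> as a balanced search tree instead gives the logarithmic bounds. For the values
  in (iii) a call may also be answered by a single comparison inside \<open>F\<close>; two disjoint comparisons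
  and one further element still cost three mistakes after one more call.\<close>

subsection \<open>Learners from knowledge sets\<close>

text \<open>Both bounds are games on the set of instances still possible. For the adversary this
  loses nothing: legality of a memoryless oracle is a separate condition on each sample, so the
  legal answers given during play extend to an oracle fixed in advance. What shapes the lower bounds
  is that no concept is empty, since a threshold contains the minimum of its order. A position
  therefore needs a nonempty bottom part, which is then itself a possible answer. The sentinel
  supplies it; otherwise one instance has to serve as minimum, and the first call costs the
  adversary exactly this instance, which is why no call and one call have the same value
  \<open>T - 1\<close>. The count \<open>2 * (T - 1)\<close> is common to both conventions: there
  are \<open>T + 1\<close> elements with one initial segment known, or \<open>T\<close> elements
  with none. In (iii), paying each call with an element leaves 5 - 3 = 2 free elements, and a
  complete tree inside five elements has depth two only; a call paid with a comparison keeps all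
  elements free, and this yields the third mistake.\<close>

lemma calls_simps [simp]:
  "calls [] = 0" "calls (h @ [e]) = calls h + (if is_answer e then 1 else 0)"
  by (simp_all add: calls_def)

lemma rounds_simps [simp]:
  "rounds [] = 0" "rounds (h @ [e]) = rounds h + (if is_round e then 1 else 0)"
  by (simp_all add: rounds_def)

lemma mistakes_simps [simp]:
  "mistakes [] = 0"
  "mistakes (h @ [e]) = mistakes h + (if is_round e \<and> predicted e \<noteq> revealed e then 1 else 0)"
  by (simp_all add: mistakes_def)

lemma length_history: "length h = rounds h + calls h"
proof (induction h rule: rev_induct)
  case (snoc e h)
  then show ?case by (cases e) auto
qed simp

lemma mistakes_le_rounds: "mistakes h \<le> rounds h"
  by (induction h rule: rev_induct) auto

lemma rounds_play_le: "rounds (play xs L c A n) \<le> length xs"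
  by (induction n) (auto simp: Let_def)

lemma play_prefix: "n \<le> k \<Longrightarrow> \<exists>h'. play xs L c A k = play xs L c A n @ h'"
  by (induction k rule: dec_induct) (auto simp: Let_def)

lemma mistakes_play_mono:
  assumes "n \<le> k" shows "mistakes (play xs L c A n) \<le> mistakes (play xs L c A k)"
proof -
  have "mistakes h \<le> mistakes (h @ h')" for h h' :: "'a history"
    by (simp add: mistakes_def)
  with play_prefix[OF assms] show ?thesis by metis
qed

lemma total_mistakes_le: "total_mistakes xs Q L i \<le> length xs"
  by (auto simp: total_mistakes_def case_prod_beta
      intro: order_trans[OF mistakes_le_rounds rounds_play_le])

section \<open>Estimates for the minimum over learners of the maximum over instances\<close>

lemma finite_nat_bounded_image: "(\<And>x. x \<in> S \<Longrightarrow> f x \<le> (n :: nat)) \<Longrightarrow> finite (f ` S)"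
  by (rule finite_subset[of _ "{..n}"]) auto

lemma minimax_le:
  assumes L: "L \<in> learners X R xs Q" and ne: "instances X R \<noteq> {}"
    and le: "\<And>i. i \<in> instances X R \<Longrightarrow> total_mistakes xs Q L i \<le> m"
  shows "minimax X R xs Q \<le> m"
proof -
  have fin: "finite (total_mistakes xs Q L ` instances X R)" for L
    by (rule finite_nat_bounded_image) (rule total_mistakes_le)
  have Max_le: "(MAX i\<in>instances X R. total_mistakes xs Q L i) \<le> length xs" for L
    using fin ne by (simp add: total_mistakes_le)
  have "finite ((\<lambda>L. MAX i\<in>instances X R. total_mistakes xs Q L i) ` learners X R xs Q)"
    by (rule finite_nat_bounded_image) (rule Max_le)
  then have "minimax X R xs Q \<le> (MAX i\<in>instances X R. total_mistakes xs Q L i)"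
    unfolding minimax_def using L by simp
  also have "\<dots> \<le> m" using fin ne le by auto
  finally show ?thesis .
qed

lemma minimax_ge:
  assumes ne: "instances X R \<noteq> {}"
    and ge: "\<And>L. L \<in> learners X R xs Q \<Longrightarrow> \<exists>i \<in> instances X R. m \<le> total_mistakes xs Q L i"
  shows "m \<le> minimax X R xs Q"
proof -
  have fin: "finite (total_mistakes xs Q L ` instances X R)" for L
    by (rule finite_nat_bounded_image) (rule total_mistakes_le)
  have Max_le: "(MAX i\<in>instances X R. total_mistakes xs Q L i) \<le> length xs" for L
    using fin ne by (simp add: total_mistakes_le)
  have fin2: "finite ((\<lambda>L. MAX i\<in>instances X R. total_mistakes xs Q L i) ` learners X R xs Q)"
    by (rule finite_nat_bounded_image) (rule Max_le)
  \<comment> \<open>\<open>Min\<close> needs a nonempty set of learners; one that never calls meets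
    every budget.\<close>
  have "calls (play xs (\<lambda>_. Predict True) c A n) = 0" for c :: "'a concept" and A n
    by (induction n) (auto simp: Let_def)
  then have "(\<lambda>_. Predict True) \<in> learners X R xs Q"
    by (auto simp: learners_def)
  moreover have "m \<le> (MAX i\<in>instances X R. total_mistakes xs Q L i)"
    if "L \<in> learners X R xs Q" for L
    using ge[OF that] fin ne by (auto simp: Max_ge_iff)
  ultimately show ?thesis
    unfolding minimax_def using fin2 by (subst Min_ge_iff) auto
qed

abbreviation target :: "'a rel \<times> 'a \<times> 'a erm \<Rightarrow> 'a concept" where
  "target i \<equiv> threshold (fst i) (fst (snd i))"

abbreviation oracle_of :: "'a rel \<times> 'a \<times> 'a erm \<Rightarrow> 'a erm" where
  "oracle_of i \<equiv> snd (snd i)"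

text \<open>\<open>solvable X xs K t q m\<close>: once \<open>t\<close> labels are revealed, a learner that knows only that the
  instance lies in \<open>K\<close> can finish with at most \<open>q\<close> calls and at most \<open>m\<close> mistakes.\<close>

inductive solvable ::
    "'a set \<Rightarrow> 'a list \<Rightarrow> ('a rel \<times> 'a \<times> 'a erm) set \<Rightarrow> nat \<Rightarrow> nat \<Rightarrow> nat \<Rightarrow> bool" for X xs where
  finish: "length xs \<le> t \<Longrightarrow> solvable X xs K t q m"
| predict: "t < length xs \<Longrightarrow> \<forall>i \<in> K. target i (xs ! t) \<noteq> b \<longrightarrow> 0 < m \<Longrightarrow>
    \<forall>y. solvable X xs {i \<in> K. target i (xs ! t) = y} (Suc t) q (if y = b then m else m - 1) \<Longrightarrow>
    solvable X xs K t q m"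
| call: "S \<subseteq> X \<times> UNIV \<Longrightarrow> \<forall>a. solvable X xs {i \<in> K. oracle_of i S = a} t q m \<Longrightarrow>
    solvable X xs K t (Suc q) m"

text \<open>Answers and labels that legality excludes lead to empty knowledge sets. There even
  \<open>m = 0\<close> imposes nothing, because the condition on wrong predictions is
  vacuous.\<close>

lemma solvable_empty: "solvable X xs {} t q m"
proof (induction "length xs - t" arbitrary: t m)
  case 0
  then show ?case by (auto intro: finish)
next
  case (Suc n)
  then show ?case by (intro predict[where b = True]) auto
qed

text \<open>The instances that agree with a history form the knowledge of the learner. The prefix
  \<open>take n h\<close> recovers the round to which a revealed label belongs.\<close>

definition agrees :: "'a list \<Rightarrow> 'a rel \<times> 'a \<times> 'a erm \<Rightarrow> 'a history \<Rightarrow> bool" where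
  "agrees xs i h \<longleftrightarrow> (\<forall>n < length h.
     (\<forall>S a. h ! n = Answer S a \<longrightarrow> oracle_of i S = a) \<and>
     (\<forall>b y. h ! n = Round b y \<longrightarrow> target i (xs ! rounds (take n h)) = y))"

lemma agrees_simps [simp]:
  "agrees xs i []"
  "agrees xs i (h @ [Answer S a]) \<longleftrightarrow> agrees xs i h \<and> oracle_of i S = a"
  "agrees xs i (h @ [Round b y]) \<longleftrightarrow> agrees xs i h \<and> target i (xs ! rounds h) = y"
  by (simp_all add: agrees_def All_less_Suc nth_append conj_commute cong: conj_cong imp_cong)

text \<open>A derivation of \<open>solvable\<close> becomes a learner by choosing, at each history,
  a move that keeps the set of agreeing instances solvable within the remaining budgets. The choice
  depends on the history alone, as a deterministic learner requires.\<close>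

theorem minimax_le_if_solvable:
  assumes ne: "instances X R \<noteq> {}" and sol: "solvable X xs (instances X R) 0 Q M"
  shows "minimax X R xs Q \<le> M"
proof -
  define K where "K h = {i \<in> instances X R. agrees xs i h}" for h
  define good where "good h S \<longleftrightarrow> S \<subseteq> X \<times> UNIV \<and> calls h < Q \<and>
     (\<forall>a. solvable X xs {i \<in> K h. oracle_of i S = a} (rounds h) (Q - Suc (calls h)) (M - mistakes h))"
    for h S
  define pgood where "pgood h b \<longleftrightarrow>
     (\<forall>i \<in> K h. target i (xs ! rounds h) \<noteq> b \<longrightarrow> 0 < M - mistakes h) \<and>
     (\<forall>y. solvable X xs {i \<in> K h. target i (xs ! rounds h) = y} (Suc (rounds h)) (Q - calls h)
        (if y = b then M - mistakes h else M - mistakes h - 1))" for h b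
  \<comment> \<open>A \<open>good\<close> call is preferred to a prediction. Any good move preserves
    the invariant, and calls are bounded since \<open>good\<close> demands
    \<open>calls h < Q\<close>.\<close>
  define L where "L h = (if \<exists>S. good h S then Call (SOME S. good h S)
     else Predict (SOME b. pgood h b))" for h
  have LS: "L h = Call S \<Longrightarrow> good h S" for h S
    unfolding L_def using someI_ex[of "good h"] by (auto split: if_splits)
  have inv: "agrees xs i h \<and> calls h \<le> Q \<and> mistakes h \<le> M \<and>
      solvable X xs (K h) (rounds h) (Q - calls h) (M - mistakes h)"
    if i: "i \<in> instances X R" and "h = play xs L (target i) (oracle_of i) n" for i n h
    using that(2)
  proof (induction n arbitrary: h)
    case 0
    with sol show ?case by (simp add: K_def)
  next
    case (Suc n)
    define g where "g = play xs L (target i) (oracle_of i) n"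
    note IH = Suc.IH[OF g_def]
    show ?case
    proof (cases "rounds g < length xs")
      case False
      then show ?thesis using IH Suc.prems g_def by (simp add: Let_def)
    next
      case True
      then have h: "h = g @ [respond (target i) (oracle_of i) (xs ! rounds g) (L g)]"
        using Suc.prems g_def by (simp add: Let_def)
      have iK: "i \<in> K g" using IH i by (simp add: K_def)
      show ?thesis
      proof (cases "\<exists>S. good g S")
        case True
        then obtain S where L: "L g = Call S" unfolding L_def by auto
        from LS[OF this] have S: "good g S" .
        have "K h = {i' \<in> K g. oracle_of i' S = oracle_of i S}"
          unfolding h L K_def by auto
        with S IH iK show ?thesis unfolding h L good_def by auto
      next
        case noS: False
        \<comment> \<open>The last rule of the derivation supplies the move: \<open>finish\<close>
          contradicts an open round, and \<open>call\<close> would yield a good call.\<close>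
        have "\<exists>b. pgood g b"
          using IH[THEN conjunct2, THEN conjunct2, THEN conjunct2]
        proof cases
          case finish
          with True show ?thesis by simp
        next
          case (predict b)
          then show ?thesis unfolding pgood_def by blast
        next
          case (call S q)
          moreover from call have "calls g < Q" "Q - Suc (calls g) = q" by auto
          ultimately have "good g S" unfolding good_def by simp
          with noS show ?thesis by blast
        qed
        then obtain b where L: "L g = Predict b" and b: "pgood g b"
          unfolding L_def using noS someI_ex[of "pgood g"] by auto
        have "K h = {i' \<in> K g. target i' (xs ! rounds g) = target i (xs ! rounds g)}"
          unfolding h L K_def by auto
        moreover have "target i (xs ! rounds g) \<noteq> b \<Longrightarrow> mistakes g < M"
          using b iK unfolding pgood_def by auto
        moreover have "solvable X xs {i' \<in> K g. target i' (xs ! rounds g) = target i (xs ! rounds g)}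
            (Suc (rounds g)) (Q - calls g) (M - mistakes h)"
          using b[unfolded pgood_def, THEN conjunct2, rule_format, of "target i (xs ! rounds g)"]
          by (cases "target i (xs ! rounds g) = b") (simp_all add: h L)
        ultimately show ?thesis using IH by (cases "target i (xs ! rounds g) = b") (simp_all add: h L Suc_le_eq)
      qed
    qed
  qed
  have "L \<in> learners X R xs Q"
    using LS inv[OF _ refl] by (auto simp: learners_def good_def)
  then show ?thesis
    using ne
  proof (rule minimax_le)
    fix i assume "i \<in> instances X R"
    from inv[OF this refl] show "total_mistakes xs Q L i \<le> M"
      by (simp add: total_mistakes_def case_prod_beta)
  qed
qed

subsection \<open>Upper bounds\<close>

lemma oracle_None:
  assumes "i \<in> instances X R" "S \<subseteq> X \<times> UNIV" "oracle_of i S = None" "w \<in> X"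
  shows "\<not> consistent (threshold (fst i) w) S"
proof
  assume c: "consistent (threshold (fst i) w) S"
  obtain r z A where i: "i = (r, z, A)" by (cases i)
  with assms have "legal_erm X r A" by (simp add: instances_def)
  note legal = this[unfolded legal_erm_def, rule_format, OF assms(2)]
  have "threshold r w \<in> concept_class X r" using assms(4) by (simp add: concept_class_def)
  with c i have "\<exists>c \<in> concept_class X r. consistent c S" by auto
  with legal assms(3) i show False by simp
qed

lemma oracle_Some:
  assumes "i \<in> instances X R" "S \<subseteq> X \<times> UNIV" "oracle_of i S = Some c"
  obtains w where "w \<in> X" "c = threshold (fst i) w" "consistent c S"
proof -
  obtain r z A where i: "i = (r, z, A)" by (cases i)
  with assms have "legal_erm X r A" by (simp add: instances_def)
  note legal = this[unfolded legal_erm_def, rule_format, OF assms(2)]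
  with legal assms(3) i have "c \<in> concept_class X r \<and> consistent c S"
    by (cases "\<exists>c \<in> concept_class X r. consistent c S") auto
  with that i show thesis by (auto simp: concept_class_def)
qed

lemma instances_linear:
  assumes "R \<subseteq> {r. linear_order_on X r}" "i \<in> instances X R"
  shows "linear_order_on X (fst i)" "fst (snd i) \<in> X"
  using assms by (auto simp: instances_def)

lemma threshold_mono:
  assumes "linear_order_on X r" "(x, y) \<in> r" "threshold r z y"
  shows "threshold r z x"
  using assms unfolding threshold_def order_on_defs trans_def by blast

lemma threshold_separates:
  assumes r: "linear_order_on X r" and "w \<in> X" "x \<in> X" "y \<in> X"
    and "threshold r w x" "\<not> threshold r w y"
  shows "(x, y) \<in> r"
proof (rule ccontr)
  assume "(x, y) \<notin> r"
  with r assms(3,4) have "(y, x) \<in> r \<or> x = y"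
    unfolding order_on_defs total_on_def by blast
  with assms threshold_mono[OF r, of y x w] show False by auto
qed

lemma solvable_no_calls: "length xs \<le> t + m \<Longrightarrow> solvable X xs K t q m"
proof (induction "length xs - t" arbitrary: K t m)
  case 0
  then show ?case by (auto intro: finish)
next
  case (Suc n)
  then show ?case by (intro predict[where b = True]) auto
qed

text \<open>One call compares the next two instances, and the comparison saves a mistake: the first
  prediction is such that, if it is wrong, the second label equals the first.\<close>

lemma solvable_pairs:
  assumes R: "R \<subseteq> {r. linear_order_on X r}" and xs: "set xs \<subseteq> X"
  shows "K \<subseteq> instances X R \<Longrightarrow> length xs \<le> t + q + m \<Longrightarrow> length xs \<le> t + 2 * m \<Longrightarrow>
    solvable X xs K t q m"
proof (induction "length xs - t" arbitrary: K t q m rule: less_induct)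
  case less
  \<comment> \<open>If \<open>m\<close> mistakes do not cover the remaining rounds, the two budget
    inequalities leave a call, a mistake and two rounds.\<close>
  consider "length xs \<le> t + m" | q' where "q = Suc q'" "Suc t < length xs" "0 < m"
    using less.prems by (cases q) (auto, fastforce)
  then show ?case
  proof cases
    case 1
    then show ?thesis by (rule solvable_no_calls)
  next
    case (2 q')
    let ?x = "xs ! t" and ?y = "xs ! Suc t"
    let ?S = "{(?x, True), (?y, False)}"
    have X: "?x \<in> X" "?y \<in> X" using 2 xs by auto
    then have S: "?S \<subseteq> X \<times> UNIV" by auto
    \<comment> \<open>A concept as answer shows \<open>?x\<close> before \<open>?y\<close>, and
      \<open>\<bottom>\<close> shows that no threshold contains \<open>?x\<close> without
      \<open>?y\<close>. With prediction 1 for \<open>?x\<close> in the first case and 0 in the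
      second, a mistake fixes the label of \<open>?y\<close>.\<close>
    have eq: "target i ?y = target i ?x"
      if i: "i \<in> instances X R" and neq: "target i ?x \<noteq> (oracle_of i ?S \<noteq> None)" for i
    proof (cases "oracle_of i ?S")
      case None
      with oracle_None[OF i S None instances_linear(2)[OF R i]] neq show ?thesis
        by (auto simp: consistent_def)
    next
      case (Some c)
      from oracle_Some[OF i S this] obtain w where
        "w \<in> X" "c = threshold (fst i) w" "consistent c ?S" .
      then have "(?x, ?y) \<in> fst i"
        using X threshold_separates[OF instances_linear(1)[OF R i], of w ?x ?y]
        by (simp add: consistent_def)
      with Some neq show ?thesis using threshold_mono[OF instances_linear(1)[OF R i]] by auto
    qed
    have IH: "solvable X xs K' (Suc (Suc t)) q' m'"
      if "K' \<subseteq> instances X R" "m' = m \<or> m' = m - 1" for K' m'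
      using that less.prems(2,3) 2 by (intro less.hyps) auto
    have "solvable X xs {i \<in> K. oracle_of i ?S = a} t q' m" (is "solvable _ _ ?K _ _ _") for a
    proof (rule predict[where b = "a \<noteq> None"]; (intro allI)?)
      fix u
      let ?K' = "{i \<in> ?K. target i ?x = u}"
      let ?m = "if u = (a \<noteq> None) then m else m - 1"
      show "solvable X xs ?K' (Suc t) q' ?m"
      proof (rule predict[where b = u]; (intro allI)?)
        show "\<forall>i \<in> ?K'. target i ?y \<noteq> u \<longrightarrow> 0 < ?m"
          using eq less.prems(1) 2 by auto
        fix v
        show "solvable X xs {i \<in> ?K'. target i ?y = v} (Suc (Suc t)) q' (if v = u then ?m else ?m - 1)"
        \<comment> \<open>The only branch with two mistakes is empty by \<open>eq\<close>, so a pair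
          costs at most one.\<close>
        proof (cases "u \<noteq> (a \<noteq> None) \<and> u \<noteq> v")
          case True
          have False if "i \<in> {i \<in> ?K'. target i ?y = v}" for i
            using True that eq[of i] less.prems(1) by auto
          then have "{i \<in> ?K'. target i ?y = v} = {}" by blast
          then show ?thesis by (simp only: solvable_empty)
        next
          case False
          then show ?thesis using less.prems(1) by (intro IH) auto
        qed
      qed (use 2 in simp)
    qed (use 2 in auto)
    then show ?thesis unfolding 2 by (intro call[OF S]) auto
  qed
qed

text \<open>Predict 1 until the label 1 is seen. That round is free of a mistake, and it exists: if
  all earlier labels are 0, the last one must be 1.\<close>

lemma solvable_nonempty_label:
  assumes "xs \<noteq> []" "\<And>i. i \<in> K \<Longrightarrow> \<exists>x \<in> set xs. target i x"
  shows "solvable X xs K 0 q (length xs - 1)"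
proof -
  have "solvable X xs K t q (length xs - Suc t)"
    if "t < length xs" "\<forall>i \<in> K. (\<forall>n < t. \<not> target i (xs ! n)) \<and> (\<exists>x \<in> set xs. target i x)" for K t
    using that
  proof (induction "length xs - t" arbitrary: K t)
    case (Suc n)
    have *: "K = {}" if "Suc t = length xs" "\<forall>i \<in> K. \<not> target i (xs ! t)"
    proof -
      have False if "i \<in> K" for i
      proof -
        obtain n where "n < length xs" "target i (xs ! n)"
          using Suc.prems(2) \<open>i \<in> K\<close> by (metis in_set_conv_nth)
        with \<open>Suc t = length xs\<close> \<open>\<forall>i \<in> K. \<not> target i (xs ! t)\<close> Suc.prems(2) \<open>i \<in> K\<close>
        show False by (metis less_SucE)
      qed
      then show ?thesis by blast
    qed
    show ?case
    proof (rule predict[where b = True]; (intro allI)?)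
      show "\<forall>i \<in> K. target i (xs ! t) \<noteq> True \<longrightarrow> 0 < length xs - Suc t"
      proof (intro ballI impI)
        fix i assume i: "i \<in> K" "target i (xs ! t) \<noteq> True"
        obtain n where "n < length xs" "target i (xs ! n)"
          using Suc.prems(2) i by (metis in_set_conv_nth)
        with i Suc.prems have "Suc t \<noteq> length xs" by (metis less_SucE)
        with Suc.prems(1) show "0 < length xs - Suc t" by simp
      qed
      fix y
      show "solvable X xs {i \<in> K. target i (xs ! t) = y} (Suc t) q
          (if y = True then length xs - Suc t else length xs - Suc t - 1)"
      proof (cases "y \<or> Suc t = length xs")
        case True
        then show ?thesis by (auto intro: solvable_no_calls)
      next
        case False
        then have "solvable X xs {i \<in> K. target i (xs ! t) = y} (Suc t) q (length xs - Suc (Suc t))"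
          using Suc.hyps(2) Suc.prems by (intro Suc.hyps(1)) (auto simp: less_Suc_eq)
        with False show ?thesis by simp
      qed
    qed (use Suc in auto)
  qed simp
  from this[of 0 K] assms show ?thesis by auto
qed

text \<open>Majority vote among the target concepts still possible: a wrong prediction leaves the
  minority, which is below half of the strict bound \<open>2 ^ Suc m\<close>. Only distinct concepts
  count, however many orders and oracles realise them.\<close>

lemma solvable_halving:
  "finite (target ` K) \<Longrightarrow> card (target ` K) < 2 ^ Suc m \<Longrightarrow> solvable X xs K t q m"
proof (induction "length xs - t" arbitrary: K t m)
  case 0
  then show ?case by (auto intro: finish)
next
  case (Suc n)
  define V where "V y = target ` {i \<in> K. target i (xs ! t) = y}" for y
  have fin: "finite (V y)" for y
    using Suc.prems(1) unfolding V_def by (rule finite_subset[rotated]) auto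
  have "target ` K = V True \<union> V False" "V True \<inter> V False = {}"
    unfolding V_def by auto
  then have sum: "card (V True) + card (V False) < 2 ^ Suc m"
    using Suc.prems(2) fin by (metis card_Un_disjoint)
  define b where "b \<longleftrightarrow> card (V False) \<le> card (V True)"
  have small: "card (V y) < 2 ^ m" if "y \<noteq> b" for y
    using sum that unfolding b_def by (cases y) auto
  show ?case
  proof (rule predict[where b = b]; (intro allI)?)
    show "\<forall>i \<in> K. target i (xs ! t) \<noteq> b \<longrightarrow> 0 < m"
    proof (intro ballI impI)
      fix i assume "i \<in> K" "target i (xs ! t) \<noteq> b"
      then have "target i \<in> V (\<not> b)" unfolding V_def by (intro imageI) auto
      then have "V (\<not> b) \<noteq> {}" by blast
      then have "0 < card (V (\<not> b))" using fin by (simp add: card_gt_0_iff)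
      with small[of "\<not> b"] show "0 < m" by (cases m) auto
    qed
    fix y
    let ?m = "if y = b then m else m - 1"
    have "card (V y) < 2 ^ Suc ?m"
    proof (cases "y = b")
      case False
      show ?thesis using small[OF False] False by (cases m) auto
    next
      case True
      then show ?thesis using sum by (cases y) auto
    qed
    with Suc.hyps(2) fin[of y] show
      "solvable X xs {i \<in> K. target i (xs ! t) = y} (Suc t) q ?m"
      unfolding V_def by (intro Suc.hyps(1)) auto
  qed (use Suc in auto)
qed

text \<open>The learner collects sets \<open>D\<close> that are initial segments of the unknown order. Two calls,
  asking for a concept that contains exactly one of two elements not yet separated, yield a new one,
  so \<open>2 * (card X - 1)\<close> calls determine the order.\<close>

lemma solvable_sorting:
  assumes R: "R \<subseteq> {r. linear_order_on X r}" and X: "finite X"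
  shows "K \<subseteq> instances X R \<Longrightarrow>
    \<forall>i \<in> K. \<forall>D \<in> \<D>. \<forall>x \<in> D. \<forall>y. (y, x) \<in> fst i \<longrightarrow> y \<in> D \<Longrightarrow>
    2 * (card X - card ((\<lambda>x. {D \<in> \<D>. x \<in> D}) ` X)) \<le> q \<Longrightarrow> card X < 2 ^ Suc m \<Longrightarrow>
    solvable X xs K t q m"
proof (induction "card X - card ((\<lambda>x. {D \<in> \<D>. x \<in> D}) ` X)" arbitrary: K \<D> q rule: less_induct)
  case less
  \<comment> \<open>Elements with equal signatures are not separated by any known initial segment;
    the number of signatures measures progress.\<close>
  define sig where "sig D x = {D' \<in> D. x \<in> D'}" for D and x :: 'a
  note prems = less.prems[folded sig_def]
  note lin = instances_linear[OF R subsetD[OF prems(1)]]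
  show ?case
  proof (cases "inj_on (sig \<D>) X")
    case True
    \<comment> \<open>Some member of \<open>\<D>\<close> contains exactly one of \<open>x\<close>
      and \<open>y\<close>. Being an initial segment of both orders, it places that element first in
      both.\<close>
    have sep: "(x, y) \<in> fst i \<longleftrightarrow> (x, y) \<in> fst j"
      if ij: "i \<in> K" "j \<in> K" and "x \<in> X" "y \<in> X" for i j x y
    proof (cases "x = y")
      case True
      then show ?thesis using lin ij \<open>x \<in> X\<close> unfolding order_on_defs refl_on_def by blast
    next
      case False
      then have "sig \<D> x \<noteq> sig \<D> y" using \<open>inj_on (sig \<D>) X\<close> that by (auto dest: inj_onD)
      then obtain D where D: "D \<in> \<D>" "(x \<in> D) \<noteq> (y \<in> D)" unfolding sig_def by auto
      have tot: "(x, y) \<in> fst i \<or> (y, x) \<in> fst i" "(x, y) \<in> fst j \<or> (y, x) \<in> fst j"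
        using lin ij that False unfolding order_on_defs total_on_def by blast+
      show ?thesis using D tot prems(2) ij by blast
    qed
    have "target i = threshold (fst j) (fst (snd i))" if "i \<in> K" "j \<in> K" for i j
    proof (intro ext)
      fix x
      have "fst i \<subseteq> X \<times> X" "fst j \<subseteq> X \<times> X"
        using lin that unfolding order_on_defs refl_on_def by auto
      then show "target i x \<longleftrightarrow> threshold (fst j) (fst (snd i)) x"
        using sep[OF that, of x "fst (snd i)"] unfolding threshold_def by auto
    qed
    \<comment> \<open>All targets are thresholds of a single order, hence at most
      \<open>card X\<close> many, and halving applies.\<close>
    then have sub: "target ` K \<subseteq> threshold (fst j) ` X" if "j \<in> K" for j
      using that lin(2) by blast
    have "finite (target ` K) \<and> card (target ` K) \<le> card X"
    proof (cases "K = {}")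
      case False
      then obtain j where "j \<in> K" by auto
      with sub X show ?thesis
        by (meson card_image_le card_mono finite_imageI finite_subset le_trans)
    qed simp
    with prems(4) show ?thesis by (intro solvable_halving) auto
  next
    case False
    then obtain p n where pn: "p \<in> X" "n \<in> X" "p \<noteq> n" "sig \<D> p = sig \<D> n"
      unfolding inj_on_def by blast
    have lt: "card (sig \<D> ` X) < card X"
      using False X card_image_le inj_on_iff_eq_card le_neq_implies_less by blast
    with prems(3) have "q = Suc (Suc (q - 2))" by linarith
    then obtain q' where q: "q = Suc (Suc q')" by blast
    let ?S = "\<lambda>b. {(p, b), (n, \<not> b)}"
    have S: "?S b \<subseteq> X \<times> UNIV" for b using pn by auto
    \<comment> \<open>A returned concept is a threshold of every remaining order, so its extension
      may join \<open>\<D>\<close>, and it separates \<open>p\<close> from \<open>n\<close>. The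
      inequality on \<open>q''\<close> covers success at the first and at the second call.\<close>
    have some: "solvable X xs K' t q'' m"
      if K': "K' \<subseteq> K" "\<forall>i \<in> K'. oracle_of i (?S b) = Some c" and q'': "q' \<le> q''" for K' b c q''
    proof -
      let ?D = "insert {x. c x} \<D>"
      have down: "\<forall>i \<in> K'. \<forall>D \<in> ?D. \<forall>x \<in> D. \<forall>y. (y, x) \<in> fst i \<longrightarrow> y \<in> D"
      proof (intro ballI allI impI)
        fix i D x y assume i: "i \<in> K'" and D: "D \<in> ?D" "x \<in> D" "(y, x) \<in> fst i"
        have iK: "i \<in> K" "i \<in> instances X R"
          using i K'(1) prems(1) by blast+
        show "y \<in> D"
        proof (cases "D \<in> \<D>")
          case True
          then show ?thesis using prems(2)[rule_format, OF iK(1) True D(2,3)] by blast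
        next
          case False
          then have Dc: "D = {x. c x}" using D by auto
          have "oracle_of i (?S b) = Some c" using K'(2) i by blast
          from oracle_Some[OF iK(2) S this] obtain w where "c = threshold (fst i) w" by blast
          then show ?thesis using D Dc threshold_mono[OF lin(1)[OF iK(1)]] by auto
        qed
      qed
      show ?thesis
      proof (cases "K' = {}")
        case False
        then obtain i where i: "i \<in> K'" by auto
        then have "i \<in> instances X R" using K'(1) prems(1) by blast
        moreover have "oracle_of i (?S b) = Some c" using K'(2) i by blast
        ultimately have "consistent c (?S b)" using oracle_Some[OF _ S[of b]] by blast
        then have c: "c p = b" "c n = (\<not> b)" by (auto simp: consistent_def)
        have "card (sig \<D> ` X) < card (sig ?D ` X)"
        proof -
          \<comment> \<open>Dropping the new set maps the new signatures onto the old ones and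
            identifies those of \<open>p\<close> and \<open>n\<close>, so there are strictly more
            new ones.\<close>
          have im: "(\<lambda>s. {D \<in> s. D \<in> \<D>}) ` sig ?D ` X = sig \<D> ` X"
            unfolding image_image by (intro image_cong) (auto simp: sig_def)
          have "{x. c x} \<in> sig ?D p \<longleftrightarrow> {x. c x} \<notin> sig ?D n" using c by (simp add: sig_def)
          then have "sig ?D p \<noteq> sig ?D n" by blast
          moreover have restr: "{D \<in> sig ?D x. D \<in> \<D>} = sig \<D> x" for x
            unfolding sig_def by auto
          then have "{D \<in> sig ?D p. D \<in> \<D>} = {D \<in> sig ?D n. D \<in> \<D>}"
            by (simp only: pn(4))
          ultimately have "\<not> inj_on (\<lambda>s. {D \<in> s. D \<in> \<D>}) (sig ?D ` X)"
            using pn(1,2) by (meson imageI inj_onD)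
          then have "card ((\<lambda>s. {D \<in> s. D \<in> \<D>}) ` sig ?D ` X) < card (sig ?D ` X)"
            using X by (meson card_image_le finite_imageI inj_on_iff_eq_card le_neq_implies_less)
          with im show ?thesis by simp
        qed
        moreover have "card (sig ?D ` X) \<le> card X" by (rule card_image_le[OF X])
        ultimately have "card X - card (sig ?D ` X) < card X - card (sig \<D> ` X)"
          and "2 * (card X - card (sig ?D ` X)) \<le> q''"
          using prems(3) q q'' lt by linarith+
        then show ?thesis
          using K'(1) prems(1,4) down by (intro less.hyps[of ?D, folded sig_def]) blast+
      qed (simp add: solvable_empty)
    qed
    \<comment> \<open>In a total order the threshold at the lower of \<open>p\<close> and
      \<open>n\<close> fits one of the two samples, so the two answers cannot both be
      \<open>\<bottom>\<close>.\<close>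
    have none: "K' = {}"
      if K': "K' \<subseteq> K" "\<forall>i \<in> K'. oracle_of i (?S True) = None \<and> oracle_of i (?S False) = None" for K'
    proof -
      have False if "i \<in> K'" for i
      proof -
        have i: "i \<in> K" "i \<in> instances X R" using K'(1) prems(1) that by blast+
        have "(p, n) \<in> fst i \<or> (n, p) \<in> fst i" "(p, p) \<in> fst i" "(n, n) \<in> fst i"
          "\<not> ((p, n) \<in> fst i \<and> (n, p) \<in> fst i)"
          using lin(1)[OF i(1)] pn unfolding order_on_defs total_on_def refl_on_def antisym_def
          by blast+
        moreover have "oracle_of i (?S True) = None" "oracle_of i (?S False) = None"
          using K'(2) that by blast+
        ultimately show False
          using oracle_None[OF i(2) S[of True] _ pn(1)] oracle_None[OF i(2) S[of False] _ pn(2)]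
          by (auto simp: consistent_def threshold_def)
      qed
      then show ?thesis by blast
    qed
    show ?thesis unfolding q
    proof (rule call[OF S[of True]]; intro allI)
      fix a
      show "solvable X xs {i \<in> K. oracle_of i (?S True) = a} t (Suc q') m" (is "solvable _ _ ?K _ _ _")
      proof (cases a)
        case (Some c)
        then show ?thesis by (intro some[of _ True c]) auto
      next
        case None
        show ?thesis
        proof (rule call[OF S[of False]]; intro allI)
          fix a'
          show "solvable X xs {i \<in> ?K. oracle_of i (?S False) = a'} t q' m"
          proof (cases a')
            case (Some c)
            then show ?thesis by (intro some[of _ False c]) auto
          next
            case None
            with \<open>a = None\<close> have "{i \<in> ?K. oracle_of i (?S False) = a'} = {}"
              by (intro none) auto
            then show ?thesis by (simp only: solvable_empty)
          qed
        qed
      qed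
    qed
  qed
qed

subsection \<open>Lower bounds from adversaries\<close>

definition list_order :: "'a list \<Rightarrow> 'a rel" where
  "list_order l = {(l ! i, l ! j) | i j. i \<le> j \<and> j < length l}"

text \<open>The concepts of the order that \<open>l\<close> lists. The empty prefix is excluded
  because each threshold contains its own \<open>z\<close>.\<close>

definition segments :: "'a list \<Rightarrow> 'a concept set" where
  "segments l = {\<lambda>x. x \<in> set p | p s. l = p @ s \<and> p \<noteq> []}"

text \<open>Legality for one sample. An oracle is legal exactly when each of its answers is, which
  lets the adversary commit to answers one sample at a time.\<close>

definition legal_answer :: "'a list \<Rightarrow> 'a sample \<Rightarrow> 'a concept option \<Rightarrow> bool" where
  "legal_answer l S a \<longleftrightarrow>
     (if \<exists>c \<in> segments l. consistent c S
      then \<exists>c \<in> segments l. consistent c S \<and> a = Some c else a = None)"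

lemma linear_order_list_order:
  assumes "distinct l" shows "linear_order_on (set l) (list_order l)"
proof -
  have mem: "(l ! i, l ! j) \<in> list_order l \<longleftrightarrow> i \<le> j" if "i < length l" "j < length l" for i j
  proof
    assume "(l ! i, l ! j) \<in> list_order l"
    then obtain i' j' where "l ! i = l ! i'" "l ! j = l ! j'" "i' \<le> j'" "j' < length l"
      by (auto simp: list_order_def)
    with assms that show "i \<le> j" by (simp add: nth_eq_iff_index_eq)
  qed (use that in \<open>auto simp: list_order_def\<close>)
  have sub: "list_order l \<subseteq> set l \<times> set l" by (auto simp: list_order_def)
  have "refl_on (set l) (list_order l)"
    using sub mem by (auto simp: refl_on_def in_set_conv_nth)
  moreover have "trans (list_order l)"
  proof (rule transI)
    fix x y z assume *: "(x, y) \<in> list_order l" "(y, z) \<in> list_order l"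
    with sub have "x \<in> set l" "y \<in> set l" "z \<in> set l" by auto
    with * mem show "(x, z) \<in> list_order l" by (auto simp: in_set_conv_nth)
  qed
  moreover have "antisym (list_order l)"
  proof (rule antisymI)
    fix x y assume *: "(x, y) \<in> list_order l" "(y, x) \<in> list_order l"
    with sub have "x \<in> set l" "y \<in> set l" by auto
    with * mem show "x = y" by (auto simp: in_set_conv_nth)
  qed
  moreover have "total_on (set l) (list_order l)"
    using mem by (auto simp: total_on_def in_set_conv_nth)
  ultimately show ?thesis using sub by (simp add: order_on_defs)
qed

lemma threshold_list_order:
  assumes "distinct (p @ s)" "p \<noteq> []"
  shows "threshold (list_order (p @ s)) (last p) = (\<lambda>x. x \<in> set p)"
proof (intro ext iffI)
  let ?k = "length p - 1"
  have last: "last p = (p @ s) ! ?k" "?k < length (p @ s)"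
    using assms(2) by (cases p; simp add: last_conv_nth nth_append)+
  {
    fix x assume "threshold (list_order (p @ s)) (last p) x"
    then obtain i j where "x = (p @ s) ! i" "last p = (p @ s) ! j" "i \<le> j" "j < length (p @ s)"
      by (auto simp: threshold_def list_order_def)
    moreover from this have "j = ?k"
      using last assms(1) by (metis nth_eq_iff_index_eq)
    ultimately have "i < length p" "x = p ! i" using assms(2)
      by (auto simp: nth_append Suc_le_eq[symmetric] neq_Nil_conv)
    then show "x \<in> set p" by simp
  next
    fix x assume "x \<in> set p"
    then obtain i where "i < length p" "x = p ! i" by (auto simp: in_set_conv_nth)
    then have "x = (p @ s) ! i" "i \<le> ?k" by (auto simp: nth_append)
    with last show "threshold (list_order (p @ s)) (last p) x"
      unfolding threshold_def list_order_def by blast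
  }
qed

lemma concept_class_list_order:
  assumes "distinct l" shows "concept_class (set l) (list_order l) = segments l"
proof (intro set_eqI iffI)
  fix c assume "c \<in> concept_class (set l) (list_order l)"
  then obtain z where z: "z \<in> set l" "c = threshold (list_order l) z"
    by (auto simp: concept_class_def)
  then obtain p s where "l = (p @ [z]) @ s" by (auto simp: in_set_conv_decomp)
  with z threshold_list_order[of "p @ [z]" s] assms have "c = (\<lambda>x. x \<in> set (p @ [z]))" by simp
  with \<open>l = (p @ [z]) @ s\<close> show "c \<in> segments l" unfolding segments_def by blast
next
  fix c assume "c \<in> segments l"
  then obtain p s where "l = p @ s" "p \<noteq> []" "c = (\<lambda>x. x \<in> set p)" by (auto simp: segments_def)
  with threshold_list_order[of p s] assms show "c \<in> concept_class (set l) (list_order l)"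
    unfolding concept_class_def by (intro image_eqI[of _ _ "last p"]) auto
qed

lemma legal_erm_list_order:
  "distinct l \<Longrightarrow> set l = X \<Longrightarrow>
   legal_erm X (list_order l) A \<longleftrightarrow> (\<forall>S \<subseteq> X \<times> UNIV. legal_answer l S (A S))"
  using concept_class_list_order[of l] by (auto simp: legal_erm_def legal_answer_def)

lemma legal_answer_exists: "\<exists>a. legal_answer l S a"
  by (auto simp: legal_answer_def)

text \<open>A pair \<open>(p, s)\<close> stands for the order listed by \<open>p @ s\<close> with target concept \<open>set p\<close>.
  \<open>forcing X xs K t q m\<close>: the adversary can keep the instance in \<open>K\<close> and force \<open>m\<close> further
  mistakes of a learner that has \<open>q\<close> calls left after \<open>t\<close> rounds.\<close>

inductive forcing ::
    "'a set \<Rightarrow> 'a list \<Rightarrow> ('a list \<times> 'a list) set \<Rightarrow> nat \<Rightarrow> nat \<Rightarrow> nat \<Rightarrow> bool" for X xs where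
  none: "K \<noteq> {} \<Longrightarrow> forcing X xs K t q 0"
| step: "t < length xs \<Longrightarrow>
    (\<And>b. \<exists>y K' m'. K' \<subseteq> K \<and> (\<forall>(p, s) \<in> K'. xs ! t \<in> set p \<longleftrightarrow> y) \<and>
       m \<le> m' + (if b = y then 0 else 1) \<and> forcing X xs K' (Suc t) q m') \<Longrightarrow>
    (\<And>q' S. q = Suc q' \<Longrightarrow> S \<subseteq> X \<times> UNIV \<Longrightarrow> \<exists>a K'. K' \<subseteq> K \<and>
       (\<forall>(p, s) \<in> K'. legal_answer (p @ s) S a) \<and> forcing X xs K' t q' m) \<Longrightarrow>
    forcing X xs K t q m"

lemma forcing_nonempty: "forcing X xs K t q m \<Longrightarrow> K \<noteq> {}"
  by (induction rule: forcing.induct) blast+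

lemma forcing_mono:
  assumes "forcing X xs K t q m" "K \<subseteq> K'" shows "forcing X xs K' t q m"
  using assms(1)
proof cases
  case none
  with assms(2) show ?thesis by (auto intro: forcing.none)
next
  case step
  show ?thesis
  proof (rule forcing.step)
    fix b
    from step(2)[of b] obtain y K1 m' where "K1 \<subseteq> K" "\<forall>(p, s) \<in> K1. xs ! t \<in> set p \<longleftrightarrow> y"
      "m \<le> m' + (if b = y then 0 else 1)" "forcing X xs K1 (Suc t) q m'" by blast
    with assms(2) show "\<exists>y K1 m'. K1 \<subseteq> K' \<and> (\<forall>(p, s) \<in> K1. xs ! t \<in> set p \<longleftrightarrow> y) \<and>
        m \<le> m' + (if b = y then 0 else 1) \<and> forcing X xs K1 (Suc t) q m'"
      by (intro exI[of _ y] exI[of _ K1] exI[of _ m']) auto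
  next
    fix q' and S :: "'a sample" assume "q = Suc q'" "S \<subseteq> X \<times> UNIV"
    from step(3)[OF this] obtain a K1 where "K1 \<subseteq> K"
      "\<forall>(p, s) \<in> K1. legal_answer (p @ s) S a" "forcing X xs K1 t q' m" by blast
    with assms(2) show "\<exists>a K1. K1 \<subseteq> K' \<and> (\<forall>(p, s) \<in> K1. legal_answer (p @ s) S a) \<and>
        forcing X xs K1 t q' m"
      by (intro exI[of _ a] exI[of _ K1]) auto
  qed (use step(1) in simp)
qed

text \<open>The learner is run against a table \<open>G\<close> of answers already given. Every
  instance in \<open>K\<close>, with any legal oracle extending the table, produces the same
  history; in the end one such instance is picked and its oracle completed.\<close>

theorem minimax_ge_if_forcing:
  assumes ne: "instances X R \<noteq> {}"
    and K: "K \<subseteq> {(p, s). p \<noteq> [] \<and> distinct (p @ s) \<and> set (p @ s) = X \<and> list_order (p @ s) \<in> R}"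
      (is "_ \<subseteq> ?Adm")
    and force: "forcing X xs K 0 Q m"
  shows "m \<le> minimax X R xs Q"
proof (rule minimax_ge[OF ne])
  fix L assume L: "L \<in> learners X R xs Q"
  define extends where "extends A G \<longleftrightarrow> (\<forall>S a. G S = Some a \<longrightarrow> A S = a)"
    for A :: "'a erm" and G :: "'a sample \<Rightarrow> 'a concept option option"
  \<comment> \<open>\<open>Q \<le> calls h + q\<close> is only an inequality: a repeated call uses
    up the budget of the learner but leaves \<open>q\<close> unchanged.\<close>
  have claim: "\<exists>i \<in> instances X R. mistakes h + m \<le> total_mistakes xs Q L i"
    if "forcing X xs K t q m" "K \<subseteq> ?Adm"
      "\<forall>(p, s) \<in> K. \<forall>A. legal_erm X (list_order (p @ s)) A \<and> extends A G \<longrightarrow>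
         play xs L (\<lambda>x. x \<in> set p) A (length h) = h"
      "\<forall>(p, s) \<in> K. \<forall>S a. G S = Some a \<longrightarrow> legal_answer (p @ s) S a"
      "rounds h = t" "Q \<le> calls h + q"
    for K t q m h G
    using that
  proof (induction "length xs + Q - length h" arbitrary: K t q m h G rule: less_induct)
    case less
    note prems = less.prems
    from forcing_nonempty[OF prems(1)] obtain p s where ps: "(p, s) \<in> K" by auto
    then have adm: "p \<noteq> []" "distinct (p @ s)" "set (p @ s) = X" "list_order (p @ s) \<in> R"
      using prems(2) by auto
    \<comment> \<open>Samples not yet asked receive any answer that is legal for the order
      \<open>p @ s\<close>.\<close>
    define A where "A S = (case G S of None \<Rightarrow> SOME a. legal_answer (p @ s) S a | Some a \<Rightarrow> a)" for S
    have "legal_answer (p @ s) S (A S)" for S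
      using prems(4) ps someI_ex[OF legal_answer_exists] unfolding A_def by (auto split: option.split)
    then have legal: "legal_erm X (list_order (p @ s)) A"
      using adm by (simp add: legal_erm_list_order)
    have ext: "extends A G" by (simp add: extends_def A_def)
    define i where "i = (list_order (p @ s), last p, A)"
    have i: "i \<in> instances X R" using adm legal by (auto simp: i_def instances_def)
    have target: "threshold (list_order (p @ s)) (last p) = (\<lambda>x. x \<in> set p)"
      using adm by (intro threshold_list_order)
    have play: "play xs L (\<lambda>x. x \<in> set p) A (length h) = h"
      using prems(3) ps legal ext by blast
    have calls_le: "calls (play xs L (\<lambda>x. x \<in> set p) A n) \<le> Q" for n
      using L i target by (fastforce simp: learners_def i_def)
    have h: "rounds h \<le> length xs" "calls h \<le> Q"
      using play calls_le rounds_play_le by metis+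
    show ?case
      using prems(1)
    proof cases
      case none
      have "mistakes h \<le> mistakes (play xs L (\<lambda>x. x \<in> set p) A (length xs + Q))"
        using mistakes_play_mono[of "length h" "length xs + Q"] play h
        by (metis add_mono length_history)
      with i none target show ?thesis by (auto simp: total_mistakes_def i_def intro!: bexI[of _ i])
    next
      case step
      have len: "length h < length xs + Q"
        using step(1) prems(5) h by (simp add: length_history)
      have play_Suc: "play xs L c B (Suc (length h)) = h @ [respond c B (xs ! t) (L h)]"
        if "play xs L c B (length h) = h" for c B
        using that step(1) prems(5) by simp
      show ?thesis
      proof (cases "L h")
        case (Predict b)
        from step(2)[of b] obtain y K' m' where K': "K' \<subseteq> K"
          "\<forall>(p, s) \<in> K'. xs ! t \<in> set p \<longleftrightarrow> y" "m \<le> m' + (if b = y then 0 else 1)"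
          "forcing X xs K' (Suc t) q m'" by blast
        let ?h = "h @ [Round b y]"
        have "\<exists>i \<in> instances X R. mistakes ?h + m' \<le> total_mistakes xs Q L i"
        proof (rule less.hyps[where h = ?h and G = G, OF _ K'(4)])
          show "\<forall>(p, s) \<in> K'. \<forall>A. legal_erm X (list_order (p @ s)) A \<and> extends A G \<longrightarrow>
             play xs L (\<lambda>x. x \<in> set p) A (length ?h) = ?h"
          proof clarify
            fix p s B assume "(p, s) \<in> K'" "legal_erm X (list_order (p @ s)) B" "extends B G"
            moreover from this have "play xs L (\<lambda>x. x \<in> set p) B (length h) = h"
              using prems(3) K'(1) by blast
            ultimately show "play xs L (\<lambda>x. x \<in> set p) B (length ?h) = ?h"
              using Predict play_Suc K'(2) by auto
          qed
          show "\<forall>(p, s) \<in> K'. \<forall>S a. G S = Some a \<longrightarrow> legal_answer (p @ s) S a"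
            using prems(4) K'(1) by blast
        qed (use prems(2,5,6) K'(1) len in auto)
        moreover have "mistakes h + m \<le> mistakes ?h + m'" using K'(3) by auto
        ultimately show ?thesis by (meson le_trans)
      next
        case (Call S)
        have S: "S \<subseteq> X \<times> UNIV" using L Call by (auto simp: learners_def)
        have "calls h < Q"
          using calls_le[of "Suc (length h)"] play_Suc[OF play] Call by simp
        show ?thesis
        proof (cases "G S")
          \<comment> \<open>For a repeated sample memorylessness forces the old answer, and
            \<open>K\<close> is kept.\<close>
          case (Some a)
          let ?h = "h @ [Answer S a]"
          have "\<exists>i \<in> instances X R. mistakes ?h + m \<le> total_mistakes xs Q L i"
          proof (rule less.hyps[where h = ?h and G = G, OF _ prems(1,2)])
            show "\<forall>(p, s) \<in> K. \<forall>A. legal_erm X (list_order (p @ s)) A \<and> extends A G \<longrightarrow>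
               play xs L (\<lambda>x. x \<in> set p) A (length ?h) = ?h"
            proof clarify
              fix p s B assume "(p, s) \<in> K" "legal_erm X (list_order (p @ s)) B" "extends B G"
              moreover from this have "play xs L (\<lambda>x. x \<in> set p) B (length h) = h" "B S = a"
                using prems(3) Some by (blast, auto simp: extends_def)
              ultimately show "play xs L (\<lambda>x. x \<in> set p) B (length ?h) = ?h"
                using Call play_Suc by simp
            qed
          qed (use prems(4,5,6) len in auto)
          then show ?thesis by simp
        next
          case None
          obtain q' where q: "q = Suc q'" using prems(6) \<open>calls h < Q\<close> by (cases q) auto
          from step(3)[OF q S] obtain a K' where K': "K' \<subseteq> K"
            "\<forall>(p, s) \<in> K'. legal_answer (p @ s) S a" "forcing X xs K' t q' m" by blast
          let ?h = "h @ [Answer S a]" and ?G = "G(S \<mapsto> a)"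
          have "\<exists>i \<in> instances X R. mistakes ?h + m \<le> total_mistakes xs Q L i"
          proof (rule less.hyps[where h = ?h and G = ?G, OF _ K'(3)])
            have ext: "extends B G" "B S = a" if "extends B ?G" for B
            proof -
              have B: "?G S' = Some a' \<Longrightarrow> B S' = a'" for S' a'
                using that unfolding extends_def by blast
              show "B S = a" by (rule B) simp
              show "extends B G" unfolding extends_def
              proof (intro allI impI)
                fix S' a' assume "G S' = Some a'"
                with None show "B S' = a'" by (intro B) auto
              qed
            qed
            show "\<forall>(p, s) \<in> K'. \<forall>A. legal_erm X (list_order (p @ s)) A \<and> extends A ?G \<longrightarrow>
               play xs L (\<lambda>x. x \<in> set p) A (length ?h) = ?h"
            proof clarify
              fix p s B assume "(p, s) \<in> K'" "legal_erm X (list_order (p @ s)) B" "extends B ?G"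
              moreover from this have "play xs L (\<lambda>x. x \<in> set p) B (length h) = h"
                using prems(3) K'(1) ext by blast
              ultimately show "play xs L (\<lambda>x. x \<in> set p) B (length ?h) = ?h"
                using Call play_Suc ext(2) by simp
            qed
            show "\<forall>(p, s) \<in> K'. \<forall>S a. ?G S = Some a \<longrightarrow> legal_answer (p @ s) S a"
            proof clarify
              fix p s S' a' assume "(p, s) \<in> K'" "?G S' = Some a'"
              with prems(4) K'(1,2) show "legal_answer (p @ s) S' a'"
                by (cases "S' = S") (simp, blast, simp, blast)
            qed
          qed (use prems(2,5,6) K'(1) len q in auto)
          then show ?thesis by simp
        qed
      qed
    qed
  qed
  show "\<exists>i \<in> instances X R. m \<le> total_mistakes xs Q L i"
    using claim[OF force K, of "\<lambda>_. None" "[]"] by simp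
qed

subsection \<open>Positions of the adversary\<close>

definition positives :: "'a sample \<Rightarrow> 'a set" where "positives S = {x. (x, True) \<in> S}"
definition negatives :: "'a sample \<Rightarrow> 'a set" where "negatives S = {x. (x, False) \<in> S}"

lemma consistent_iff: "consistent c S \<longleftrightarrow> (\<forall>x \<in> positives S. c x) \<and> (\<forall>x \<in> negatives S. \<not> c x)"
proof -
  have "consistent c S \<longleftrightarrow> (\<forall>x y. (x, y) \<in> S \<longrightarrow> c x = y)" by (auto simp: consistent_def)
  also have "\<dots> \<longleftrightarrow> (\<forall>x \<in> positives S. c x) \<and> (\<forall>x \<in> negatives S. \<not> c x)"
    by (auto simp: positives_def negatives_def all_bool_eq)
  finally show ?thesis .
qed

lemma positives_negatives_subset: "S \<subseteq> X \<times> UNIV \<Longrightarrow> positives S \<subseteq> X" "S \<subseteq> X \<times> UNIV \<Longrightarrow> negatives S \<subseteq> X"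
  by (auto simp: positives_def negatives_def)

lemma legal_NoneI:
  assumes "\<And>p s. l = p @ s \<Longrightarrow> p \<noteq> [] \<Longrightarrow> positives S \<subseteq> set p \<Longrightarrow> negatives S \<inter> set p = {} \<Longrightarrow> False"
  shows "legal_answer l S None"
  using assms unfolding legal_answer_def segments_def consistent_iff by fastforce

lemma legal_SomeI:
  assumes "l = p @ s" "p \<noteq> []" "positives S \<subseteq> set p" "negatives S \<inter> set p = {}" "set p = C"
  shows "legal_answer l S (Some (\<lambda>x. x \<in> C))"
proof -
  have "(\<lambda>x. x \<in> C) \<in> segments l" using assms unfolding segments_def by blast
  moreover have "consistent (\<lambda>x. x \<in> C) S" using assms by (auto simp: consistent_iff)
  ultimately show ?thesis unfolding legal_answer_def by auto
qed

lemma segment_split: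
  assumes "p @ s = a @ x # b"
  shows "x \<notin> set p \<Longrightarrow> set p \<subseteq> set a"
    and "x \<notin> set a \<Longrightarrow> x \<in> set p \<Longrightarrow> set a \<subseteq> set p"
  using assms by (auto simp: append_eq_append_conv2 append_eq_Cons_conv)

text \<open>The listings of \<open>F\<close> compatible with the comparisons \<open>\<rho>\<close>:
  \<open>(y, x) \<in> \<rho>\<close> demands \<open>y\<close> before \<open>x\<close>. Pairs that
  leave \<open>F\<close> have no effect, so \<open>\<rho>\<close> can stay fixed while
  \<open>F\<close> shrinks.\<close>

definition arrangements :: "'a set \<Rightarrow> 'a rel \<Rightarrow> 'a list set" where
  "arrangements F \<rho> = {fs. distinct fs \<and> set fs = F \<and> sorted_wrt (\<lambda>x y. (y, x) \<notin> \<rho>) fs}"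

text \<open>The orders that list first \<open>bs\<close>, then a member of \<open>FS\<close>, then \<open>us\<close>; the target labels \<open>bs\<close>
  with 1 and \<open>us\<close> with 0.\<close>

definition states :: "'a list \<Rightarrow> 'a list set \<Rightarrow> 'a list \<Rightarrow> ('a list \<times> 'a list) set" where
  "states bs FS us = {(bs @ f, g @ us) | f g. f @ g \<in> FS \<and> bs @ f \<noteq> []}"

lemma states_mono:
  assumes "\<And>fs. fs \<in> FS' \<Longrightarrow> b @ fs @ u \<in> FS"
  shows "states (bs @ b) FS' (u @ us) \<subseteq> states bs FS us"
proof clarify
  fix p s assume "(p, s) \<in> states (bs @ b) FS' (u @ us)"
  then obtain f g where "p = bs @ (b @ f)" "s = (g @ u) @ us" "f @ g \<in> FS'" "p \<noteq> []"
    unfolding states_def by auto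
  with assms[of "f @ g"] show "(p, s) \<in> states bs FS us"
    unfolding states_def by (intro CollectI exI[of _ "b @ f"] exI[of _ "g @ u"]) auto
qed

lemma states_append:
  assumes "(p, s) \<in> states bs FS us"
  obtains fs where "fs \<in> FS" "p @ s = bs @ fs @ us"
  using assms unfolding states_def by fastforce

lemma arrangements_cong:
  "\<rho> \<inter> F \<times> F = \<rho>' \<inter> F \<times> F \<Longrightarrow> arrangements F \<rho> = arrangements F \<rho>'"
  unfolding arrangements_def
  by (intro Collect_cong conj_cong refl iffI; erule sorted_wrt_mono_rel[rotated]) blast+

lemma arrangements_nonempty: "finite F \<Longrightarrow> arrangements F {} \<noteq> {}"
  using finite_distinct_list[of F] by (auto simp: arrangements_def sorted_wrt_true)

context
  fixes X :: "'a set" and xs :: "'a list"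
begin

text \<open>All free elements are still to be labelled, so each can cost a mistake. The bottom part
  may contain the sentinel, which does not occur in the sequence.\<close>

definition board :: "nat \<Rightarrow> 'a list \<Rightarrow> 'a set \<Rightarrow> 'a list \<Rightarrow> bool" where
  "board t bs F us \<longleftrightarrow> distinct (bs @ us) \<and> F \<inter> set (bs @ us) = {} \<and> finite F \<and>
     F \<subseteq> set (drop t xs) \<and> set bs \<union> F \<union> set us = X"

text \<open>The calls whose answer is not already determined by the order outside \<open>F\<close>.\<close>

definition active :: "'a list \<Rightarrow> 'a set \<Rightarrow> 'a list \<Rightarrow> 'a sample \<Rightarrow> bool" where
  "active bs F us S \<longleftrightarrow> positives S \<subseteq> set bs \<union> F \<and> negatives S \<subseteq> F \<union> set us \<and> positives S \<inter> negatives S = {} \<and>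
     positives S \<inter> F \<noteq> {} \<and> negatives S \<inter> F \<noteq> {}"

abbreviation forces :: "nat \<Rightarrow> 'a list \<Rightarrow> 'a set \<Rightarrow> 'a rel \<Rightarrow> 'a list \<Rightarrow> nat \<Rightarrow> nat \<Rightarrow> bool" where
  "forces t bs F \<rho> us q m \<equiv> forcing X xs (states bs (arrangements F \<rho>) us) t q m"

text \<open>Either the sample contradicts itself, or the question is settled by a prefix that ends
  outside the interior of \<open>F\<close> and so is the same set for all arrangements. Nonemptiness
  of \<open>bs\<close> makes \<open>set bs\<close> a concept.\<close>

lemma inactive_answer:
  assumes board: "board t bs F us" and bs: "bs \<noteq> []" and S: "S \<subseteq> X \<times> UNIV"
    and inactive: "\<not> active bs F us S"
  shows "\<exists>a. \<forall>fs. distinct fs \<and> set fs = F \<longrightarrow> legal_answer (bs @ fs @ us) S a"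
proof -
  have sub: "positives S \<subseteq> set bs \<union> F \<union> set us" "negatives S \<subseteq> set bs \<union> F \<union> set us"
    using positives_negatives_subset[OF S] board by (simp_all add: board_def)
  have "positives S \<inter> negatives S \<noteq> {} \<or> positives S \<inter> F = {} \<or> negatives S \<inter> F = {}"
    if "positives S \<inter> set us = {}" "negatives S \<inter> set bs = {}"
  proof -
    have "positives S \<subseteq> set bs \<union> F" "negatives S \<subseteq> F \<union> set us" using sub that by auto
    with inactive show ?thesis unfolding active_def by auto
  qed
  moreover have "positives S \<subseteq> set bs" if "positives S \<inter> set us = {}" "positives S \<inter> F = {}"
    using sub(1) that by auto
  moreover have "positives S \<subseteq> set bs \<union> F" if "positives S \<inter> set us = {}" using sub(1) that by auto
  moreover have "negatives S \<subseteq> set us" if "negatives S \<inter> set bs = {}" "negatives S \<inter> F = {}"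
    using sub(2) that by auto
  ultimately consider "positives S \<inter> negatives S \<noteq> {}" | "positives S \<inter> set us \<noteq> {}"
    | "negatives S \<inter> set bs \<noteq> {}" "positives S \<inter> set us = {}"
    | "positives S \<subseteq> set bs" "negatives S \<inter> set bs = {}"
    | "positives S \<subseteq> set bs \<union> F" "negatives S \<subseteq> set us"
    by metis
  then show ?thesis
  proof cases
    case 1
    then show ?thesis by (intro exI[of _ None] allI impI legal_NoneI) blast
  next
    case 2
    then have "\<exists>x \<in> set us. x \<in> positives S" by blast
    then obtain u x u' where us: "us = u @ x # u'" "x \<in> positives S" "\<forall>y \<in> set u'. y \<notin> positives S"
      by (rule split_list_last_propE)
    \<comment> \<open>Every prefix of the order that contains \<open>x\<close> contains
      \<open>?C\<close>, and \<open>?C\<close> holds all positives, so it is the smallest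
      candidate.\<close>
    let ?C = "set bs \<union> F \<union> set u \<union> {x}"
    show ?thesis
    proof (cases "negatives S \<inter> ?C = {}")
      case True
      then show ?thesis
        using us sub by (intro exI[of _ "Some (\<lambda>x. x \<in> ?C)"] allI impI
            legal_SomeI[where p = "bs @ _ @ u @ [x]" and s = u']) auto
    next
      case False
      show ?thesis
      proof (intro exI[of _ None] allI impI legal_NoneI)
        fix fs p s assume fs: "distinct fs \<and> set fs = F" and l: "bs @ fs @ us = p @ s"
          and p: "positives S \<subseteq> set p" "negatives S \<inter> set p = {}"
        have "x \<notin> set (bs @ fs @ u)" using board us fs by (auto simp: board_def)
        with segment_split(2)[of p s "bs @ fs @ u" x u'] l us p(1) have "?C \<subseteq> set p"
          using fs by auto
        with p False show False by blast
      qed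
    qed
  next
    case 3
    then have "\<exists>x \<in> set bs. x \<in> negatives S" by blast
    then obtain b x b' where b: "bs = b @ x # b'" "x \<in> negatives S" "\<forall>y \<in> set b. y \<notin> negatives S"
      by (rule split_list_first_propE)
    show ?thesis
    \<comment> \<open>Prefixes that avoid \<open>x\<close> lie within \<open>b\<close>, the largest
      candidate; if \<open>b\<close> is empty, no concept avoids \<open>x\<close>.\<close>
    proof (cases "b \<noteq> [] \<and> positives S \<subseteq> set b")
      case True
      then show ?thesis
        using b by (intro exI[of _ "Some (\<lambda>x. x \<in> set b)"] allI impI
            legal_SomeI[where p = b and s = "x # b' @ _ @ us"]) auto
    next
      case False
      show ?thesis
      proof (intro exI[of _ None] allI impI legal_NoneI)
        fix fs p s assume l: "bs @ fs @ us = p @ s" and p: "p \<noteq> []" "positives S \<subseteq> set p" "negatives S \<inter> set p = {}"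
        with segment_split(1)[of p s b x "b' @ fs @ us"] b have "set p \<subseteq> set b" by auto
        with p False show False by auto
      qed
    qed
  next
    case 4
    with bs show ?thesis
      by (intro exI[of _ "Some (\<lambda>x. x \<in> set bs)"] allI impI
          legal_SomeI[where p = bs and s = "_ @ us"]) auto
  next
    case 5
    have "negatives S \<inter> (set bs \<union> F) = {}" using 5 board by (auto simp: board_def)
    with 5 bs show ?thesis
      by (intro exI[of _ "Some (\<lambda>x. x \<in> set bs \<union> F)"] allI impI
          legal_SomeI[where p = "bs @ _" and s = us]) auto
  qed
qed

lemma label_bottom: "(p, s) \<in> states bs FS us \<Longrightarrow> x \<in> set bs \<Longrightarrow> x \<in> set p"
  unfolding states_def by auto

lemma label_top:
  "(p, s) \<in> states bs FS us \<Longrightarrow> x \<notin> set bs \<Longrightarrow> \<forall>fs \<in> FS. x \<notin> set fs \<Longrightarrow> x \<notin> set p"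
  unfolding states_def by auto

lemma board_Suc: "board t bs F us \<Longrightarrow> xs ! t \<notin> F \<Longrightarrow> t < length xs \<Longrightarrow> board (Suc t) bs F us"
  unfolding board_def using Cons_nth_drop_Suc[of t xs, symmetric] by (auto dest: subsetD)

lemma board_move:
  assumes "board t bs F us" "set b \<union> set u \<subseteq> F" "distinct (b @ u)"
  shows "board t (bs @ b) (F - set b - set u) (u @ us)"
  using assms unfolding board_def by auto

text \<open>Labels outside \<open>F\<close> and inactive calls can be answered alike for all states,
  so the position comes back at a later round or with fewer calls. Only free instances and active
  calls remain to be treated, at whatever \<open>t\<close> and \<open>q\<close> they occur.\<close>

lemma forces_SucI:
  assumes board: "board t bs F us" and bs: "bs \<noteq> []" and F: "F \<noteq> {}" and "q \<le> Q"
    and predict: "\<And>t q y. board t bs F us \<Longrightarrow> t < length xs \<Longrightarrow> xs ! t \<in> F \<Longrightarrow> q \<le> Q \<Longrightarrow>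
      \<exists>K \<subseteq> states bs (arrangements F \<rho>) us. (\<forall>(p, s) \<in> K. xs ! t \<in> set p \<longleftrightarrow> y) \<and>
        forcing X xs K (Suc t) q m"
    and call: "\<And>t q S. board t bs F us \<Longrightarrow> q < Q \<Longrightarrow> active bs F us S \<Longrightarrow>
      \<exists>a. \<exists>K \<subseteq> states bs (arrangements F \<rho>) us. (\<forall>(p, s) \<in> K. legal_answer (p @ s) S a) \<and>
        forcing X xs K t q (Suc m)"
  shows "forces t bs F \<rho> us q (Suc m)"
  using board \<open>q \<le> Q\<close>
proof (induction "length xs - t + q" arbitrary: t q rule: less_induct)
  case less
  have "drop t xs \<noteq> []" using less.prems(1) F by (auto simp: board_def)
  then have t: "t < length xs" by simp
  let ?K = "states bs (arrangements F \<rho>) us"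
  show ?case
  proof (rule forcing.step[OF t])
    fix b
    show "\<exists>y K m'. K \<subseteq> ?K \<and> (\<forall>(p, s) \<in> K. xs ! t \<in> set p \<longleftrightarrow> y) \<and>
        Suc m \<le> m' + (if b = y then 0 else 1) \<and> forcing X xs K (Suc t) q m'"
    proof (cases "xs ! t \<in> F")
      case True
      from predict[OF less.prems(1) t True less.prems(2), of "\<not> b"] obtain K where
        "K \<subseteq> ?K" "\<forall>(p, s) \<in> K. xs ! t \<in> set p \<longleftrightarrow> \<not> b" "forcing X xs K (Suc t) q m" by blast
      then show ?thesis by (intro exI[of _ "\<not> b"] exI[of _ K] exI[of _ m]) auto
    next
      case False
      then have "board (Suc t) bs F us" using less.prems(1) t board_Suc by blast
      then have "forcing X xs ?K (Suc t) q (Suc m)"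
        using less.prems(2) t by (intro less.hyps) auto
      moreover have "\<forall>(p, s) \<in> ?K. xs ! t \<in> set p \<longleftrightarrow> xs ! t \<in> set bs"
        using False by (auto simp: arrangements_def dest: label_bottom label_top)
      ultimately show ?thesis
        by (intro exI[of _ "xs ! t \<in> set bs"] exI[of _ ?K] exI[of _ "Suc m"]) auto
    qed
  next
    fix q' and S :: "'a sample" assume q: "q = Suc q'" and S: "S \<subseteq> X \<times> UNIV"
    show "\<exists>a K. K \<subseteq> ?K \<and> (\<forall>(p, s) \<in> K. legal_answer (p @ s) S a) \<and> forcing X xs K t q' (Suc m)"
    proof (cases "active bs F us S")
      case True
      with call[OF less.prems(1) _ True, of q'] q less.prems(2) show ?thesis by auto
    next
      case False
      from inactive_answer[OF less.prems(1) bs S this] obtain a where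
        a: "distinct fs \<and> set fs = F \<Longrightarrow> legal_answer (bs @ fs @ us) S a" for fs by blast
      have "\<forall>(p, s) \<in> ?K. legal_answer (p @ s) S a"
      proof clarify
        fix p s assume "(p, s) \<in> ?K"
        then obtain fs where "fs \<in> arrangements F \<rho>" "p @ s = bs @ fs @ us" by (rule states_append)
        with a[of fs] show "legal_answer (p @ s) S a" by (simp add: arrangements_def)
      qed
      moreover have "forcing X xs ?K t q' (Suc m)"
        using less.prems q by (intro less.hyps) auto
      ultimately show ?thesis by blast
    qed
  qed
qed

section \<open>Moving elements out of \<open>F\<close>, and legal replies to active calls\<close>

lemma move_subset:
  assumes "set b \<union> set u \<subseteq> F" "distinct (b @ u)"
    and "sorted_wrt (\<lambda>x y. (y, x) \<notin> \<rho>) (b @ u)"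
    and "\<And>x y. x \<in> set b \<Longrightarrow> y \<in> F - set b \<Longrightarrow> (y, x) \<notin> \<rho>"
    and "\<And>x y. x \<in> set u \<Longrightarrow> y \<in> F - set u \<Longrightarrow> (x, y) \<notin> \<rho>"
  shows "states (bs @ b) (arrangements (F - set b - set u) \<rho>) (u @ us)
    \<subseteq> states bs (arrangements F \<rho>) us"
  using assms by (intro states_mono) (auto simp: arrangements_def sorted_wrt_append)

text \<open>A prefix that avoids \<open>n\<close> lies within \<open>bs\<close> and so misses the
  positive example in \<open>F\<close>.\<close>

lemma answer_bottom:
  assumes "active bs F us S" "n \<in> negatives S" "\<And>fs. fs \<in> FS \<Longrightarrow> set fs = F - {n}"
    "F \<inter> set bs = {}" 
  shows "\<forall>(p, s) \<in> states (bs @ [n]) FS us. legal_answer (p @ s) S None"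
proof clarify
  fix p s assume "(p, s) \<in> states (bs @ [n]) FS us"
  then obtain fs where fs: "fs \<in> FS" "p @ s = bs @ n # fs @ us" by (auto elim: states_append)
  show "legal_answer (p @ s) S None"
  proof (rule legal_NoneI)
    fix p' s' assume *: "p @ s = p' @ s'" "positives S \<subseteq> set p'" "negatives S \<inter> set p' = {}"
    then have "set p' \<subseteq> set bs"
      using segment_split(1)[of p' s' bs n "fs @ us"] fs assms(2) by auto
    with * assms(1,4) show False by (auto simp: active_def)
  qed
qed

text \<open>A prefix that contains \<open>x\<close> contains the rest of \<open>F\<close>, where a
  negative example lies.\<close>

lemma answer_top:
  assumes "active bs F us S" "x \<in> positives S" "\<And>fs. fs \<in> FS \<Longrightarrow> set fs = F - {x}" "x \<notin> set bs"
  shows "\<forall>(p, s) \<in> states bs FS (x # us). legal_answer (p @ s) S None"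
proof clarify
  fix p s assume "(p, s) \<in> states bs FS (x # us)"
  then obtain fs where fs: "fs \<in> FS" "p @ s = (bs @ fs) @ x # us" by (auto elim: states_append)
  show "legal_answer (p @ s) S None"
  proof (rule legal_NoneI)
    fix p' s' assume *: "p @ s = p' @ s'" "positives S \<subseteq> set p'" "negatives S \<inter> set p' = {}"
    then have "set (bs @ fs) \<subseteq> set p'"
      using segment_split(2)[of p' s' "bs @ fs" x us] fs assms(2-) by auto
    with * assms fs show False by (auto simp: active_def)
  qed
qed

lemma answer_below:
  assumes "active bs F us S" "F \<inter> set bs = {}" "C \<subseteq> F" "set b = C"
    and "positives S \<inter> F \<subseteq> C" "negatives S \<inter> C = {}" "F \<inter> set us = {}" "set bs \<inter> set us = {}" "bs \<noteq> []"
  shows "\<forall>(p, s) \<in> states (bs @ b) FS us. legal_answer (p @ s) S (Some (\<lambda>x. x \<in> set bs \<union> C))"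
proof clarify
  fix p s assume "(p, s) \<in> states (bs @ b) FS us"
  then obtain fs where "p @ s = (bs @ b) @ fs @ us" by (auto elim: states_append)
  with assms show "legal_answer (p @ s) S (Some (\<lambda>x. x \<in> set bs \<union> C))"
    by (intro legal_SomeI[where p = "bs @ b" and s = "fs @ us"]) (auto simp: active_def)
qed

lemma answer_above:
  assumes "active bs F us S" "F \<inter> set bs = {}" "C \<subseteq> F" "\<And>fs. fs \<in> FS \<Longrightarrow> set fs = C"
    and "positives S \<inter> F \<subseteq> C" "negatives S \<inter> C = {}" "F \<inter> set us = {}" "set bs \<inter> set us = {}" "bs \<noteq> []"
  shows "\<forall>(p, s) \<in> states bs FS (u @ us). legal_answer (p @ s) S (Some (\<lambda>x. x \<in> set bs \<union> C))"
proof clarify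
  fix p s assume "(p, s) \<in> states bs FS (u @ us)"
  then obtain fs where "p @ s = (bs @ fs) @ u @ us" "fs \<in> FS" by (auto elim: states_append)
  with assms show "legal_answer (p @ s) S (Some (\<lambda>x. x \<in> set bs \<union> C))"
    by (intro legal_SomeI[where p = "bs @ fs" and s = "u @ us"]) (auto simp: active_def)
qed

text \<open>A comparison alone makes \<open>\<bottom>\<close> legal: a prefix with \<open>x\<close>
  also contains \<open>n\<close>, which precedes it in every state. No free element is used
  up.\<close>

lemma answer_related:
  assumes "x \<in> positives S" "n \<in> negatives S" "x \<in> F" "n \<in> F" "x \<noteq> n" "(n, x) \<in> \<rho>" "F \<inter> set bs = {}"
  shows "\<forall>(p, s) \<in> states bs (arrangements F \<rho>) us. legal_answer (p @ s) S None"
proof clarify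
  fix p s assume "(p, s) \<in> states bs (arrangements F \<rho>) us"
  then obtain fs where fs: "distinct fs" "set fs = F" "sorted_wrt (\<lambda>x y. (y, x) \<notin> \<rho>) fs"
    "p @ s = bs @ fs @ us" by (auto simp: arrangements_def elim: states_append)
  then obtain f g where f: "fs = f @ x # g" using assms(3) by (metis split_list)
  with fs(1-3) assms(4-6) have n: "n \<in> set f" "x \<notin> set f" by (auto simp: sorted_wrt_append)
  show "legal_answer (p @ s) S None"
  proof (rule legal_NoneI)
    fix p' s' assume *: "p @ s = p' @ s'" "positives S \<subseteq> set p'" "negatives S \<inter> set p' = {}"
    then have "set (bs @ f) \<subseteq> set p'"
      using segment_split(2)[of p' s' "bs @ f" x "g @ us"] fs(4) f n(2) assms(1,3,7) by auto
    with * n(1) assms(2) show False by auto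
  qed
qed

end

subsection \<open>Antichains and search trees\<close>

lemma forces_antichain:
  "board X xs t bs F us \<Longrightarrow> bs \<noteq> [] \<Longrightarrow> m + q \<le> card F \<Longrightarrow> forces X xs t bs F {} us q m"
proof (induction "card F" arbitrary: t bs F us q m)
  case 0
  then have "states bs (arrangements F {}) us \<noteq> {}"
    using arrangements_nonempty[of F] by (fastforce simp: board_def states_def)
  with 0 show ?case by (auto intro: forcing.none)
next
  case (Suc k)
  note board = Suc.prems(1) and bs = Suc.prems(2)
  have fin: "finite F" using board by (simp add: board_def)
  have bottom: "states (bs @ [x]) (arrangements (F - {x}) {}) us \<subseteq> states bs (arrangements F {}) us"
    and top: "states bs (arrangements (F - {x}) {}) (x # us) \<subseteq> states bs (arrangements F {}) us"
    if "x \<in> F" for x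
    using move_subset[of "[x]" "[]" F "{}" bs us] move_subset[of "[]" "[x]" F "{}" bs us] that by auto
  have board': "board X xs t (bs @ [x]) (F - {x}) us" "board X xs t bs (F - {x}) (x # us)"
    if "x \<in> F" "board X xs t bs F us" for x t
    using board_move[OF that(2), of "[x]" "[]"] board_move[OF that(2), of "[]" "[x]"] that(1) by auto
  have card: "card (F - {x}) = k" if "x \<in> F" for x
    using Suc.hyps(2) that fin by simp
  show ?case
  proof (cases m)
    case 0
    have "states bs (arrangements F {}) us \<noteq> {}"
      using arrangements_nonempty[OF fin] bs by (fastforce simp: states_def)
    with 0 show ?thesis by (auto intro: forcing.none)
  next
    case m: (Suc m')
    show ?thesis unfolding m
    proof (rule forces_SucI[OF board bs _ order_refl])
      fix t q' y
      let ?x = "xs ! t"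
      assume *: "board X xs t bs F us" "t < length xs" "?x \<in> F" "q' \<le> q"
      have IH: "forces X xs (Suc t) bs' (F - {?x}) {} us' q' m'"
        if "board X xs t bs' (F - {?x}) us'" "bs' \<noteq> []" for bs' us'
        using that * Suc.prems m Suc.hyps(2) card by (intro Suc.hyps(1) board_Suc) auto
      show "\<exists>K \<subseteq> states bs (arrangements F {}) us. (\<forall>(p, s) \<in> K. ?x \<in> set p \<longleftrightarrow> y) \<and>
        forcing X xs K (Suc t) q' m'"
      proof (cases y)
        case True
        then show ?thesis
          using IH board'(1)[OF *(3,1)] bottom[OF *(3)]
          by (intro exI[of _ "states (bs @ [?x]) (arrangements (F - {?x}) {}) us"])
            (auto intro: label_bottom)
      next
        case False
        have "?x \<notin> set bs" using * by (auto simp: board_def)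
        with False show ?thesis
          using IH board'(2)[OF *(3,1)] bs top[OF *(3)]
          by (intro exI[of _ "states bs (arrangements (F - {?x}) {}) (?x # us)"])
            (auto simp: arrangements_def dest: label_top)
      qed
    next
      fix t q' S
      assume *: "board X xs t bs F us" "q' < q" "active bs F us S"
      then obtain n where n: "n \<in> negatives S" "n \<in> F" by (auto simp: active_def)
      have "forces X xs t (bs @ [n]) (F - {n}) {} us q' (Suc m')"
        using * n Suc.prems m Suc.hyps(2) card board' by (intro Suc.hyps(1)) auto
      moreover have "\<forall>(p, s) \<in> states (bs @ [n]) (arrangements (F - {n}) {}) us. legal_answer (p @ s) S None"
        using * n by (intro answer_bottom) (auto simp: board_def arrangements_def)
      ultimately show "\<exists>a. \<exists>K \<subseteq> states bs (arrangements F {}) us.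
        (\<forall>(p, s) \<in> K. legal_answer (p @ s) S a) \<and> forcing X xs K t q' (Suc m')"
        using bottom[OF n(2)] by blast
    qed (use Suc.hyps(2) in auto)
  qed
qed

lemma least_index:
  assumes "F \<subseteq> set (drop t xs)" "F \<noteq> {}"
  obtains t' where "t \<le> t'" "t' < length xs" "xs ! t' \<in> F" "\<And>k. t \<le> k \<Longrightarrow> k < t' \<Longrightarrow> xs ! k \<notin> F"
    "F - {xs ! t'} \<subseteq> set (drop (Suc t') xs)"
proof -
  let ?P = "\<lambda>k. t \<le> k \<and> k < length xs \<and> xs ! k \<in> F"
  obtain x where "x \<in> F" "x \<in> set (drop t xs)" using assms by blast
  then obtain k where "k < length xs - t" "xs ! (t + k) \<in> F" by (auto simp: in_set_conv_nth)
  then have "?P (t + k)" by simp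
  then have least: "?P (LEAST k. ?P k)" by (rule LeastI)
  define t' where "t' = (LEAST k. ?P k)"
  have min: "xs ! k \<notin> F" if "t \<le> k" "k < t'" for k
    using not_less_Least[of k ?P] that least unfolding t'_def by auto
  have "F - {xs ! t'} \<subseteq> set (drop (Suc t') xs)"
  proof
    fix y assume y: "y \<in> F - {xs ! t'}"
    then obtain j where j: "j < length xs - t" "xs ! (t + j) = y"
      using assms(1) by (auto simp: in_set_conv_nth dest!: subsetD)
    then have "t' < t + j" using min[of "t + j"] y
      by (metis DiffD1 DiffD2 le_add1 linorder_neqE_nat singletonI)
    then obtain i where "t + j = Suc t' + i" by (metis less_iff_Suc_add add_Suc)
    with j have "i < length (drop (Suc t') xs)" "drop (Suc t') xs ! i = y" by auto
    then show "y \<in> set (drop (Suc t') xs)" by (metis nth_mem)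
  qed
  with least min show thesis unfolding t'_def by (intro that) auto
qed

text \<open>With the order of \<open>F\<close> revealed, calls are useless.\<close>

lemma forcing_revealed:
  assumes t': "t' < length xs" "xs ! t' = u" and dist: "distinct (pre @ fs @ post)" "pre \<noteq> []"
    and fs: "fs = f @ u # g"
    and sub: "\<And>q. forcing X xs (states (pre @ f @ [u]) {g} post) (Suc t') q d"
      "\<And>q. forcing X xs (states pre {f} (u # g @ post)) (Suc t') q d"
  shows "t \<le> t' \<Longrightarrow> (\<And>k. t \<le> k \<Longrightarrow> k < t' \<Longrightarrow> xs ! k \<notin> set fs) \<Longrightarrow>
    forcing X xs (states pre {fs} post) t q (Suc d)"
proof (induction "t' - t + q" arbitrary: t q rule: less_induct)
  case less
  let ?K = "states pre {fs} post"
  show ?case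
  proof (rule forcing.step)
    show "t < length xs" using less.prems t' by simp
  next
    fix b
    show "\<exists>y K m'. K \<subseteq> ?K \<and> (\<forall>(p, s) \<in> K. xs ! t \<in> set p \<longleftrightarrow> y) \<and>
        Suc d \<le> m' + (if b = y then 0 else 1) \<and> forcing X xs K (Suc t) q m'"
    proof (cases "t = t'")
      case False
      then have "forcing X xs ?K (Suc t) q (Suc d)" using less.prems by (intro less.hyps) auto
      moreover have "xs ! t \<notin> set fs" using less.prems False by auto
      then have "\<forall>(p, s) \<in> ?K. xs ! t \<in> set p \<longleftrightarrow> xs ! t \<in> set pre"
        by (auto dest: label_bottom label_top)
      ultimately show ?thesis
        by (intro exI[of _ "xs ! t \<in> set pre"] exI[of _ ?K] exI[of _ "Suc d"]) auto
    next
      case True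
      \<comment> \<open>Either label of the root \<open>u\<close> leaves a whole subtree free: label
        1 the part \<open>g\<close> above it, label 0 the part \<open>f\<close> below it.\<close>
      let ?K1 = "states (pre @ f @ [u]) {g} post" and ?K2 = "states pre {f} (u # g @ post)"
      have "?K1 \<subseteq> ?K" "?K2 \<subseteq> ?K"
        using states_mono[of "{g}" "f @ [u]" "[]" "{fs}" pre post]
          states_mono[of "{f}" "[]" "u # g" "{fs}" pre post] fs by auto
      moreover have "\<forall>(p, s) \<in> ?K1. u \<in> set p" by (auto intro: label_bottom)
      moreover have "\<forall>(p, s) \<in> ?K2. u \<notin> set p" using dist fs by (auto dest: label_top)
      ultimately show ?thesis
        using sub t'(2) True
        by (cases b; intro exI[of _ "\<not> b"] exI[of _ "if b then ?K2 else ?K1"] exI[of _ d]) auto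
    qed
  next
    fix q' and S :: "'a sample" assume q: "q = Suc q'"
    \<comment> \<open>Legality of an answer depends on the order and not on the target, and all
      states in \<open>?K\<close> list the same order.\<close>
    obtain a where "legal_answer (pre @ fs @ post) S a" using legal_answer_exists by blast
    then have "\<forall>(p, s) \<in> ?K. legal_answer (p @ s) S a" by (auto elim!: states_append)
    moreover have "forcing X xs ?K t q' (Suc d)" using less.prems q by (intro less.hyps) auto
    ultimately show "\<exists>a K. K \<subseteq> ?K \<and> (\<forall>(p, s) \<in> K. legal_answer (p @ s) S a) \<and>
        forcing X xs K t q' (Suc d)" by blast
  qed
qed

text \<open>The order of \<open>F\<close> is a balanced search tree into which the instances are inserted in sequence.
  Any one comparison between two elements of \<open>F\<close> may be prescribed.\<close>

lemma forcing_search_tree: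
  assumes "lo \<noteq> hi"
  shows "F \<subseteq> set (drop t xs) \<Longrightarrow> finite F \<Longrightarrow> card F = 2 ^ d - 1 \<Longrightarrow>
    \<exists>fs. distinct fs \<and> set fs = F \<and> sorted_wrt (\<lambda>x y. (x, y) \<noteq> (hi, lo)) fs \<and>
      (\<forall>pre post q. pre \<noteq> [] \<and> distinct (pre @ fs @ post) \<longrightarrow>
         forcing X xs (states pre {fs} post) t q d)"
proof (induction d arbitrary: F t)
  case 0
  then have "F = {}" by simp
  then show ?case by (auto simp: states_def intro!: exI[of _ "[]"] forcing.none)
next
  case (Suc d)
  have pow: "(1::nat) \<le> 2 ^ d" by simp
  then have "card F \<noteq> 0" using Suc.prems(3) unfolding power_Suc by linarith
  then have "F \<noteq> {}" by auto
  from least_index[OF Suc.prems(1) this] obtain t' where t': "t \<le> t'" "t' < length xs" "xs ! t' \<in> F"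
    "\<And>k. t \<le> k \<Longrightarrow> k < t' \<Longrightarrow> xs ! k \<notin> F" "F - {xs ! t'} \<subseteq> set (drop (Suc t') xs)" by metis
  define u where "u = xs ! t'"
  define G where "G = F - {u}"
  define n :: nat where "n = 2 ^ d - 1"
  have G: "finite G" "card G = n + n" "F = insert u G" "u \<notin> G"
    using Suc.prems t'(3) pow by (auto simp: G_def n_def u_def)
  \<comment> \<open>The half below the root takes \<open>lo\<close> and avoids \<open>hi\<close>.
    Then \<open>lo\<close> precedes \<open>hi\<close> even if one of them is the root.\<close>
  have "\<exists>A. ({lo} \<inter> G) \<subseteq> A \<and> A \<subseteq> G - {hi} \<and> card A = n" if "n \<noteq> 0"
  proof (rule exists_subset_between)
    show "card ({lo} \<inter> G) \<le> n" using that by (simp add: card_insert_if Int_insert_left)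
    have "card G - 1 \<le> card (G - {hi})" by (simp add: card_Diff_singleton_if)
    then show "n \<le> card (G - {hi})" using that G(2) by linarith
  qed (use assms G in auto)
  moreover have "G = {}" if "n = 0" using that G by simp
  ultimately obtain A where A: "{lo} \<inter> G \<subseteq> A" "A \<subseteq> G - {hi}" "card A = n"
    by (cases "n = 0") auto
  define B where "B = G - A"
  have fin: "finite A" using A(2) G(1) by (meson finite_Diff finite_subset)
  have B: "card B = n" "G = A \<union> B" "A \<inter> B = {}" "finite A" "finite B"
    using A(2,3) G(1,2) fin card_Diff_subset[OF fin, of G] by (auto simp: B_def)
  have sub: "A \<subseteq> set (drop (Suc t') xs)" "B \<subseteq> set (drop (Suc t') xs)"
    using t'(5) A(2) B_def G_def u_def by auto
  from Suc.IH[OF sub(1) B(4)] A(3) n_def obtain f where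
    f: "distinct f" "set f = A" "sorted_wrt (\<lambda>x y. (x, y) \<noteq> (hi, lo)) f"
      "\<And>pre post q. pre \<noteq> [] \<Longrightarrow> distinct (pre @ f @ post) \<Longrightarrow>
         forcing X xs (states pre {f} post) (Suc t') q d" by blast
  from Suc.IH[OF sub(2) B(5)] B(1) n_def obtain g where
    g: "distinct g" "set g = B" "sorted_wrt (\<lambda>x y. (x, y) \<noteq> (hi, lo)) g"
      "\<And>pre post q. pre \<noteq> [] \<Longrightarrow> distinct (pre @ g @ post) \<Longrightarrow>
         forcing X xs (states pre {g} post) (Suc t') q d" by blast
  let ?fs = "f @ u # g"
  have set_fs: "set ?fs = F" using f(2) g(2) B(2) G(3) by auto
  have "distinct ?fs" using f(1,2) g(1,2) B(2,3) G(4) by auto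
  moreover have "sorted_wrt (\<lambda>x y. (x, y) \<noteq> (hi, lo)) ?fs"
  proof -
    have "hi \<notin> A" "lo \<notin> B" using A(1,2) B(2,3) by auto
    then have "x \<noteq> hi" if "x \<in> set f" for x using that f(2) by auto
    moreover have "y \<noteq> lo" if "y \<in> set g" for y using that g(2) \<open>lo \<notin> B\<close> by auto
    ultimately show ?thesis using f(3) g(3) by (simp add: sorted_wrt_append)
  qed
  moreover have "forcing X xs (states pre {?fs} post) t q (Suc d)"
    if "pre \<noteq> []" "distinct (pre @ ?fs @ post)" for pre post q
  proof (rule forcing_revealed[OF t'(2) u_def[symmetric] that(2,1) refl _ _ t'(1)])
    show "forcing X xs (states (pre @ f @ [u]) {g} post) (Suc t') q d" for q
      using that by (intro g(4)) auto
    show "forcing X xs (states pre {f} (u # g @ post)) (Suc t') q d" for q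
      using that by (intro f(4)) auto
    show "xs ! k \<notin> set ?fs" if "t \<le> k" "k < t'" for k
      using t'(4)[OF that] set_fs by blast
  qed
  ultimately show ?case using set_fs by blast
qed

text \<open>The elements of \<open>F - F0\<close> are given up: they are placed above the tree on
  \<open>F0\<close> with label 0. Comparisons from \<open>F0\<close> to them are then respected, and
  the single comparison inside \<open>F0\<close> is the one the tree can accommodate.\<close>

lemma forces_log:
  assumes board: "board X xs t bs F us" and bs: "bs \<noteq> []" and "lo \<noteq> hi"
    and F0: "F0 \<subseteq> F" "card F0 = 2 ^ d - 1"
    and \<rho>: "\<And>x y. (x, y) \<in> \<rho> \<Longrightarrow> x \<in> F \<Longrightarrow> y \<in> F \<Longrightarrow> 
      (x, y) = (lo, hi) \<and> {lo, hi} \<subseteq> F0 \<or> x \<in> F0 \<and> y \<notin> F0"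
  shows "forces X xs t bs F \<rho> us q d"
proof -
  have F: "F \<subseteq> set (drop t xs)" "finite F" "distinct (bs @ us)" "F \<inter> set (bs @ us) = {}"
    using board by (auto simp: board_def)
  have "F0 \<subseteq> set (drop t xs)" "finite F0" using F F0 by (auto simp: finite_subset)
  from forcing_search_tree[OF \<open>lo \<noteq> hi\<close> this F0(2)] obtain fs where
    fs: "distinct fs" "set fs = F0" "sorted_wrt (\<lambda>x y. (x, y) \<noteq> (hi, lo)) fs"
      "\<And>pre post q. pre \<noteq> [] \<Longrightarrow> distinct (pre @ fs @ post) \<Longrightarrow>
         forcing X xs (states pre {fs} post) t q d" by blast
  obtain ys where ys: "distinct ys" "set ys = F - F0" using F(2) by (meson finite_Diff finite_distinct_list)
  have "sorted_wrt (\<lambda>x y. (y, x) \<notin> \<rho>) fs"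
    using fs(3) by (rule sorted_wrt_mono_rel[rotated]) (use fs(2) F0(1) \<rho> in blast)
  moreover have "sorted_wrt (\<lambda>x y. (y, x) \<notin> \<rho>) ys"
    by (rule sorted_wrt_mono_rel[of _ "\<lambda>_ _. True"]) (use ys(2) \<rho> in \<open>auto simp: sorted_wrt_true\<close>)
  ultimately have "fs @ ys \<in> arrangements F \<rho>"
    using fs(1,2) ys F0(1) \<rho> by (auto simp: arrangements_def sorted_wrt_append)
  then have "states bs {fs} (ys @ us) \<subseteq> states bs (arrangements F \<rho>) us"
    using states_mono[of "{fs}" "[]" ys "arrangements F \<rho>" bs us] by auto
  moreover have "forcing X xs (states bs {fs} (ys @ us)) t q d"
    using F fs(1,2) ys F0(1) by (intro fs(4) bs) auto
  ultimately show ?thesis using forcing_mono by blast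
qed

section \<open>Moves when some comparisons inside \<open>F\<close> are known\<close>

lemma bottom_subset:
  assumes "set b \<subseteq> F" "distinct b" "sorted_wrt (\<lambda>x y. (y, x) \<notin> \<rho>) b"
    and "\<And>x y. x \<in> set b \<Longrightarrow> y \<in> F - set b \<Longrightarrow> (y, x) \<notin> \<rho>"
  shows "states (bs @ b) (arrangements (F - set b) \<rho>) us \<subseteq> states bs (arrangements F \<rho>) us"
  using move_subset[of b "[]" F \<rho> bs us] assms by simp

lemma top_subset:
  assumes "set u \<subseteq> F" "distinct u" "sorted_wrt (\<lambda>x y. (y, x) \<notin> \<rho>) u"
    and "\<And>x y. x \<in> set u \<Longrightarrow> y \<in> F - set u \<Longrightarrow> (x, y) \<notin> \<rho>"
  shows "states bs (arrangements (F - set u) \<rho>) (u @ us) \<subseteq> states bs (arrangements F \<rho>) us"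
  using move_subset[of "[]" u F \<rho> bs us] assms by simp

lemma board_bottom:
  "board X xs t bs F us \<Longrightarrow> set b \<subseteq> F \<Longrightarrow> distinct b \<Longrightarrow> board X xs t (bs @ b) (F - set b) us"
  using board_move[of X xs t bs F us b "[]"] by simp

lemma board_top:
  "board X xs t bs F us \<Longrightarrow> set u \<subseteq> F \<Longrightarrow> distinct u \<Longrightarrow> board X xs t bs (F - set u) (u @ us)"
  using board_move[of X xs t bs F us "[]" u] by simp

text \<open>An element without comparisons can go to either end, so both labels are available at the
  cost of this element only.\<close>

lemma predict_single:
  assumes board: "board X xs t bs F us" and bs: "bs \<noteq> []" and t: "t < length xs" "xs ! t \<in> F"
    and isolated: "\<And>y. y \<in> F \<Longrightarrow> (xs ! t, y) \<notin> \<rho> \<and> (y, xs ! t) \<notin> \<rho>"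
    and rest: "\<And>bs us. bs \<noteq> [] \<Longrightarrow> board X xs (Suc t) bs (F - {xs ! t}) us \<Longrightarrow>
      forces X xs (Suc t) bs (F - {xs ! t}) \<rho> us q m"
  shows "\<exists>K \<subseteq> states bs (arrangements F \<rho>) us. (\<forall>(p, s) \<in> K. xs ! t \<in> set p \<longleftrightarrow> y) \<and>
    forcing X xs K (Suc t) q m"
proof (cases y)
  case True
  let ?K = "states (bs @ [xs ! t]) (arrangements (F - {xs ! t}) \<rho>) us"
  have "?K \<subseteq> states bs (arrangements F \<rho>) us"
    using move_subset[of "[xs ! t]" "[]" F \<rho> bs us] t(2) isolated by auto
  moreover have "board X xs (Suc t) (bs @ [xs ! t]) (F - {xs ! t}) us"
    using board_move[OF board, of "[xs ! t]" "[]"] t by (intro board_Suc) auto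
  ultimately show ?thesis
    using True rest by (intro exI[of _ ?K]) (auto intro: label_bottom)
next
  case False
  let ?K = "states bs (arrangements (F - {xs ! t}) \<rho>) (xs ! t # us)"
  have "?K \<subseteq> states bs (arrangements F \<rho>) us"
    using move_subset[of "[]" "[xs ! t]" F \<rho> bs us] t(2) isolated by auto
  moreover have "board X xs (Suc t) bs (F - {xs ! t}) (xs ! t # us)"
    using board_move[OF board, of "[]" "[xs ! t]"] t by (intro board_Suc) auto
  moreover have "xs ! t \<notin> set bs" using board t(2) by (auto simp: board_def)
  ultimately show ?thesis
    using False bs rest by (intro exI[of _ ?K]) (auto simp: arrangements_def dest: label_top)
qed

text \<open>Label 1 for \<open>lo\<close> or 0 for \<open>hi\<close> removes just the instance
  asked; the opposite label drags its partner along, since \<open>hi\<close> with label 1 forces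
  \<open>lo\<close> to 1 and \<open>lo\<close> with label 0 forces \<open>hi\<close> to 0. Hence the
  two continuations.\<close>

lemma predict_pair:
  assumes board: "board X xs t bs F us" and bs: "bs \<noteq> []" and t: "t < length xs"
    and x: "xs ! t \<in> {lo, hi}" and F: "lo \<in> F" "hi \<in> F" "lo \<noteq> hi"
    and isolated: "\<And>u v. (u, v) \<in> \<rho> \<Longrightarrow> u \<in> F \<Longrightarrow> v \<in> F \<Longrightarrow> u \<in> {lo, hi} \<or> v \<in> {lo, hi} \<Longrightarrow>
      (u, v) = (lo, hi)"
    and rest: "\<And>bs us. bs \<noteq> [] \<Longrightarrow> board X xs (Suc t) bs (F - {xs ! t}) us \<Longrightarrow>
      forces X xs (Suc t) bs (F - {xs ! t}) \<rho> us q m"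
    and rest2: "\<And>bs us. bs \<noteq> [] \<Longrightarrow> board X xs (Suc t) bs (F - {lo, hi}) us \<Longrightarrow>
      forces X xs (Suc t) bs (F - {lo, hi}) \<rho> us q m"
  shows "\<exists>K \<subseteq> states bs (arrangements F \<rho>) us. (\<forall>(p, s) \<in> K. xs ! t \<in> set p \<longleftrightarrow> y) \<and>
    forcing X xs K (Suc t) q m"
proof -
  have down: "(z, lo) \<notin> \<rho>" "z \<noteq> lo \<Longrightarrow> (z, hi) \<notin> \<rho>"
    and up: "(hi, z) \<notin> \<rho>" "z \<noteq> hi \<Longrightarrow> (lo, z) \<notin> \<rho>" if "z \<in> F" for z
    using isolated[of z lo] isolated[of z hi] isolated[of hi z] isolated[of lo z] that F by auto
  show ?thesis
  proof (cases y)
    case True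
    define b where "b = (if xs ! t = lo then [lo] else [lo, hi])"
    let ?K = "states (bs @ b) (arrangements (F - set b) \<rho>) us"
    have b: "set b \<subseteq> F" "distinct b" "xs ! t \<in> set b" using x F by (auto simp: b_def)
    have "?K \<subseteq> states bs (arrangements F \<rho>) us"
      proof -
        have "sorted_wrt (\<lambda>x y. (y, x) \<notin> \<rho>) b" using down(1)[OF F(2)] by (simp add: b_def)
        moreover have "(z, x) \<notin> \<rho>" if "x \<in> set b" "z \<in> F - set b" for x z
          using that down[of z] by (auto simp: b_def split: if_splits)
        ultimately show ?thesis using move_subset[of b "[]" F \<rho> bs us] b(1,2) by simp
      qed
    moreover have "board X xs (Suc t) (bs @ b) (F - set b) us"
      using board_move[OF board, of b "[]"] t b by (intro board_Suc) auto
    then have "forcing X xs ?K (Suc t) q m"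
      using rest[of "bs @ b" us] rest2[of "bs @ b" us] bs unfolding b_def by (auto split: if_splits)
    ultimately show ?thesis
      using True b(3) by (intro exI[of _ ?K]) (auto intro: label_bottom)
  next
    case False
    define u where "u = (if xs ! t = hi then [hi] else [lo, hi])"
    let ?K = "states bs (arrangements (F - set u) \<rho>) (u @ us)"
    have u: "set u \<subseteq> F" "distinct u" "xs ! t \<in> set u" using x F by (auto simp: u_def)
    have "?K \<subseteq> states bs (arrangements F \<rho>) us"
      proof -
        have "sorted_wrt (\<lambda>x y. (y, x) \<notin> \<rho>) u" using down(1)[OF F(2)] by (simp add: u_def)
        moreover have "(x, z) \<notin> \<rho>" if "x \<in> set u" "z \<in> F - set u" for x z
          using that up[of z] by (auto simp: u_def split: if_splits)
        ultimately show ?thesis using move_subset[of "[]" u F \<rho> bs us] u(1,2) by simp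
      qed
    moreover have "board X xs (Suc t) bs (F - set u) (u @ us)"
      using board_move[OF board, of "[]" u] t u by (intro board_Suc) auto
    then have "forcing X xs ?K (Suc t) q m"
      using rest[of bs "u @ us"] rest2[of bs "u @ us"] bs unfolding u_def by (auto split: if_splits)
    moreover have "xs ! t \<notin> set bs" using board u by (auto simp: board_def)
    ultimately show ?thesis
      using False u(3) by (intro exI[of _ ?K]) (auto simp: arrangements_def dest: label_top)
  qed
qed

text \<open>A minimal element \<open>x\<close> can be spent in two ways: as a negative example at
  the bottom it makes \<open>\<bottom>\<close> legal, and as the only positive example in
  \<open>F\<close> it completes the bottom part to a consistent concept.\<close>

lemma reply_bottom:
  assumes board: "board X xs t bs F us" and bs: "bs \<noteq> []" and active: "active bs F us S"
    and x: "x \<in> F" "\<And>y. y \<in> F \<Longrightarrow> (y, x) \<notin> \<rho>" "x \<in> negatives S \<or> positives S \<inter> F = {x}"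
    and rest: "\<And>bs us. bs \<noteq> [] \<Longrightarrow> board X xs t bs (F - {x}) us \<Longrightarrow>
      forces X xs t bs (F - {x}) \<rho> us q m"
  shows "\<exists>a. \<exists>K \<subseteq> states bs (arrangements F \<rho>) us. (\<forall>(p, s) \<in> K. legal_answer (p @ s) S a) \<and>
    forcing X xs K t q m"
proof -
  let ?K = "states (bs @ [x]) (arrangements (F - {x}) \<rho>) us"
  have disj: "F \<inter> set bs = {}" "F \<inter> set us = {}" "set bs \<inter> set us = {}"
    using board by (auto simp: board_def)
  have set: "fs \<in> arrangements (F - {x}) \<rho> \<Longrightarrow> set fs = F - {x}" for fs
    by (simp add: arrangements_def)
  have "\<exists>a. \<forall>(p, s) \<in> ?K. legal_answer (p @ s) S a"
  proof (cases "x \<in> negatives S")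
    case True
    from answer_bottom[OF active True set disj(1)] show ?thesis by blast
  next
    case False
    with x(3) have "positives S \<inter> F \<subseteq> {x}" "negatives S \<inter> {x} = {}" by auto
    then have "\<forall>(p, s) \<in> ?K. legal_answer (p @ s) S (Some (\<lambda>y. y \<in> set bs \<union> {x}))"
      using x(1) by (intro answer_below[OF active disj(1) _ _ _ _ disj(2,3) bs]) auto
    then show ?thesis by blast
  qed
  moreover have "?K \<subseteq> states bs (arrangements F \<rho>) us"
    using move_subset[of "[x]" "[]" F \<rho> bs us] x(1,2) by auto
  moreover have "board X xs t (bs @ [x]) (F - {x}) us"
    using board_move[OF board, of "[x]" "[]"] x(1) by auto
  ultimately show ?thesis using rest[of "bs @ [x]" us] by blast
qed

text \<open>Dual to \<open>reply_bottom\<close>: a maximal positive example on top makes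
  \<open>\<bottom>\<close> legal, and if the only negative one in \<open>F\<close> goes there, the
  rest of \<open>F\<close> joins the answer.\<close>

lemma reply_top:
  assumes board: "board X xs t bs F us" and bs: "bs \<noteq> []" and active: "active bs F us S"
    and x: "x \<in> F" "\<And>y. y \<in> F \<Longrightarrow> (x, y) \<notin> \<rho>" "x \<in> positives S \<or> negatives S \<inter> F = {x}"
    and rest: "\<And>bs us. bs \<noteq> [] \<Longrightarrow> board X xs t bs (F - {x}) us \<Longrightarrow>
      forces X xs t bs (F - {x}) \<rho> us q m"
  shows "\<exists>a. \<exists>K \<subseteq> states bs (arrangements F \<rho>) us. (\<forall>(p, s) \<in> K. legal_answer (p @ s) S a) \<and>
    forcing X xs K t q m"
proof -
  let ?K = "states bs (arrangements (F - {x}) \<rho>) (x # us)"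
  have disj: "F \<inter> set bs = {}" "F \<inter> set us = {}" "set bs \<inter> set us = {}"
    using board by (auto simp: board_def)
  have set: "fs \<in> arrangements (F - {x}) \<rho> \<Longrightarrow> set fs = F - {x}" for fs
    by (simp add: arrangements_def)
  have "\<exists>a. \<forall>(p, s) \<in> ?K. legal_answer (p @ s) S a"
  proof (cases "x \<in> positives S")
    case True
    have "x \<notin> set bs" using disj(1) x(1) by auto
    with answer_top[OF active True set] show ?thesis by blast
  next
    case False
    with x(3) have "positives S \<inter> F \<subseteq> F - {x}" "negatives S \<inter> (F - {x}) = {}" by auto
    then have "\<forall>(p, s) \<in> states bs (arrangements (F - {x}) \<rho>) ([x] @ us).
        legal_answer (p @ s) S (Some (\<lambda>y. y \<in> set bs \<union> (F - {x})))"
      by (intro answer_above[OF active disj(1) _ set _ _ disj(2,3) bs]) auto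
    then show ?thesis by auto
  qed
  moreover have "?K \<subseteq> states bs (arrangements F \<rho>) us"
    using move_subset[of "[]" "[x]" F \<rho> bs us] x(1,2) by auto
  moreover have "board X xs t bs (F - {x}) (x # us)"
    using board_move[OF board, of "[]" "[x]"] x(1) by auto
  ultimately show ?thesis using rest[of bs "x # us"] bs by blast
qed

lemma forces_cong:
  "forces X xs t bs F \<rho>' us q m \<Longrightarrow> \<rho> \<inter> F \<times> F = \<rho>' \<inter> F \<times> F \<Longrightarrow> forces X xs t bs F \<rho> us q m"
  using arrangements_cong[of \<rho> F \<rho>'] by simp

lemma forces_two:
  assumes "board X xs t bs F us" "bs \<noteq> []" "lo \<noteq> hi" "F0 \<subseteq> F" "card F0 = 3"
    and "\<And>x y. (x, y) \<in> \<rho> \<Longrightarrow> x \<in> F \<Longrightarrow> y \<in> F \<Longrightarrow>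
      (x, y) = (lo, hi) \<and> {lo, hi} \<subseteq> F0 \<or> x \<in> F0 \<and> y \<notin> F0"
  shows "forces X xs t bs F \<rho> us q 2"
  using assms by (intro forces_log[where lo = lo and hi = hi and ?F0.0 = F0]) auto

lemma forces_two_antichain:
  assumes "board X xs t bs F us" "bs \<noteq> []" "3 \<le> card F"
    and "\<And>x y. (x, y) \<in> \<rho> \<Longrightarrow> x \<in> F \<Longrightarrow> y \<in> F \<Longrightarrow> False"
  shows "forces X xs t bs F \<rho> us q 2"
proof -
  obtain F0 where F0: "F0 \<subseteq> F" "card F0 = 3" "finite F0"
    using assms(3) by (rule obtain_subset_with_card_n)
  \<comment> \<open>Any two distinct names serve as the prescribed pair, since no comparison is to
    be respected.\<close>
  then obtain a b :: 'a where "a \<noteq> b" by (metis card_3_iff)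
  then show ?thesis by (rule forces_two[OF assms(1,2) _ F0(1,2)]) (use assms(4) in blast)
qed

text \<open>In the following three positions the free part of the order carries one or two disjoint known
  comparisons \<open>lo < hi\<close>. After any further prediction there remain three free elements with at most
  one known comparison, which cost two more mistakes however many calls are left (or two incomparable
  elements and no calls).\<close>

lemma forces_three_no_calls:
  assumes board: "board X xs t bs F us" and bs: "bs \<noteq> []"
    and F: "F = {lo, hi, a, b}" "distinct [lo, hi, a, b]"
    and \<rho>: "\<rho> \<inter> F \<times> F = {(lo, hi)}"
  shows "forces X xs t bs F \<rho> us 0 3"
proof -
  have \<rho>': "(x, y) = (lo, hi)" if "(x, y) \<in> \<rho>" "x \<in> F" "y \<in> F" for x y using \<rho> that by blast
  have "forces X xs t bs F \<rho> us 0 (Suc 2)"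
  proof (rule forces_SucI[OF board bs _ order_refl])
    fix t q y
    assume *: "board X xs t bs F us" "t < length xs" "xs ! t \<in> F" "q \<le> (0::nat)"
    have rest: "forces X xs (Suc t) bs' (F - {xs ! t}) \<rho> us' q 2"
      if "bs' \<noteq> []" "board X xs (Suc t) bs' (F - {xs ! t}) us'" for bs' us'
    proof (rule forces_two[OF that(2,1) _ order_refl])
      show "card (F - {xs ! t}) = 3" using F *(3) by auto
      show "lo \<noteq> hi" using F by simp
    qed (use \<rho>' in blast)
    show "\<exists>K \<subseteq> states bs (arrangements F \<rho>) us. (\<forall>(p, s) \<in> K. xs ! t \<in> set p \<longleftrightarrow> y) \<and>
      forcing X xs K (Suc t) q 2"
    proof (cases "xs ! t \<in> {lo, hi}")
      case True
      show ?thesis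
      proof (rule predict_pair[OF *(1) bs *(2) True])
        fix bs' us' assume b': "bs' \<noteq> []" "board X xs (Suc t) bs' (F - {lo, hi}) us'"
        have "forces X xs (Suc t) bs' (F - {lo, hi}) {} us' q 2"
          using F *(4) by (intro forces_antichain[OF b'(2,1)]) (auto simp: insert_Diff_if)
        then show "forces X xs (Suc t) bs' (F - {lo, hi}) \<rho> us' q 2"
          by (rule forces_cong) (use \<rho>' in blast)
      next
        show "lo \<in> F" "hi \<in> F" "lo \<noteq> hi" using F by auto
      qed (use \<rho>' rest in blast)+
    next
      case False
      then have "y \<in> F \<Longrightarrow> (xs ! t, y) \<notin> \<rho> \<and> (y, xs ! t) \<notin> \<rho>" for y
        using \<rho>' *(3) by blast
      then show ?thesis by (rule predict_single[OF *(1) bs *(2,3) _ rest])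
    qed
  qed (use F in auto)
  then show ?thesis by (simp add: eval_nat_numeral)
qed

text \<open>The call is usually paid with one element of a pair, which leaves the other pair and two
  more elements, as in \<open>forces_three_no_calls\<close>. The exceptions are positives in
  \<open>F\<close> equal to both lows, or negatives equal to both highs; giving these two away
  leaves three incomparable elements and no calls.\<close>

lemma forces_three_one_call:
  assumes board: "board X xs t bs F us" and bs: "bs \<noteq> []"
    and F: "F = {l1, h1, l2, h2, e}" "distinct [l1, h1, l2, h2, e]"
    and \<rho>: "\<rho> \<inter> F \<times> F = {(l1, h1), (l2, h2)}" and q: "q \<le> 1"
  shows "forces X xs t bs F \<rho> us q 3"
proof -
  have \<rho>': "(x, y) = (l1, h1) \<or> (x, y) = (l2, h2)" if "(x, y) \<in> \<rho>" "x \<in> F" "y \<in> F" for x y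
  proof -
    have "(x, y) \<in> \<rho> \<inter> F \<times> F" using that by simp
    then show ?thesis unfolding \<rho> by simp
  qed
  have "forces X xs t bs F \<rho> us q (Suc 2)"
  proof (rule forces_SucI[OF board bs _ q])
    fix t q y
    assume *: "board X xs t bs F us" "t < length xs" "xs ! t \<in> F" "q \<le> (1::nat)"
    have pair: "\<exists>K \<subseteq> states bs (arrangements F \<rho>) us. (\<forall>(p, s) \<in> K. xs ! t \<in> set p \<longleftrightarrow> y) \<and>
        forcing X xs K (Suc t) q 2"
      if p: "xs ! t \<in> {lo, hi}" and G: "F = {lo, hi, lo', hi', e}" "distinct [lo, hi, lo', hi', e]"
        and \<rho>G: "\<And>x y. (x, y) \<in> \<rho> \<Longrightarrow> x \<in> F \<Longrightarrow> y \<in> F \<Longrightarrow> (x, y) = (lo, hi) \<or> (x, y) = (lo', hi')"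
      for lo hi lo' hi'
    proof (rule predict_pair[OF *(1) bs *(2) p])
      have card: "card {lo', hi', e} = 3" "lo' \<noteq> hi'" using G(2) by auto
      show "forces X xs (Suc t) bs' (F - {xs ! t}) \<rho> us' q 2"
        if "bs' \<noteq> []" "board X xs (Suc t) bs' (F - {xs ! t}) us'" for bs' us'
        by (rule forces_two[OF that(2,1) card(2) _ card(1)]) (use G p \<rho>G in auto)
      show "forces X xs (Suc t) bs' (F - {lo, hi}) \<rho> us' q 2"
        if "bs' \<noteq> []" "board X xs (Suc t) bs' (F - {lo, hi}) us'" for bs' us'
        by (rule forces_two[OF that(2,1) card(2) _ card(1)]) (use G \<rho>G in auto)
      show "lo \<in> F" "hi \<in> F" "lo \<noteq> hi" using G by auto
      fix u v assume "(u, v) \<in> \<rho>" "u \<in> F" "v \<in> F" "u \<in> {lo, hi} \<or> v \<in> {lo, hi}"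
      with \<rho>G[of u v] G(2) show "(u, v) = (lo, hi)" by auto
    qed
    consider "xs ! t \<in> {l1, h1}" | "xs ! t \<in> {l2, h2}" | "xs ! t = e" using *(3) F by auto
    then show "\<exists>K \<subseteq> states bs (arrangements F \<rho>) us. (\<forall>(p, s) \<in> K. xs ! t \<in> set p \<longleftrightarrow> y) \<and>
        forcing X xs K (Suc t) q 2"
    proof cases
      case 1
      then show ?thesis by (rule pair) (use F \<rho>' in auto)
    next
      case 2
      then show ?thesis by (rule pair) (use F \<rho>' in auto)
    next
      case 3
      \<comment> \<open>\<open>h2\<close> is the element given up: its comparison with
        \<open>l2\<close> then points from the tree to the part above it.\<close>
      have "card {l1, h1, l2} = 3" "l1 \<noteq> h1" using F(2) by auto
      then show ?thesis
        by (intro predict_single[OF *(1) bs *(2,3)] forces_two[of _ _ _ _ _ _ l1 h1 "{l1, h1, l2}"])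
          (use F 3 \<rho>' in auto)
    qed
  next
    fix t q S
    assume *: "board X xs t bs F us" "q < (1::nat)" "active bs F us S"
    have q: "q = 0" using *(2) by simp
    have PN: "positives S \<inter> negatives S = {}" using *(3) by (simp add: active_def)
    let ?goal = "\<exists>a. \<exists>K \<subseteq> states bs (arrangements F \<rho>) us.
      (\<forall>(p, s) \<in> K. legal_answer (p @ s) S a) \<and> forcing X xs K t q (Suc 2)"
    have disj: "F \<inter> set bs = {}" "F \<inter> set us = {}" "set bs \<inter> set us = {}"
      using *(1) by (auto simp: board_def)
    have pair: ?goal
      if p: "lo \<in> negatives S \<or> hi \<in> positives S \<or> positives S \<inter> F = {lo} \<or> negatives S \<inter> F = {hi}"
        and G: "F = {lo, hi, lo', hi', e}" "distinct [lo, hi, lo', hi', e]"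
        and \<rho>G: "\<rho> \<inter> F \<times> F = {(lo, hi), (lo', hi')}"
      for lo hi lo' hi'
    proof -
      have \<rho>G': "(x, y) = (lo, hi) \<or> (x, y) = (lo', hi')" if "(x, y) \<in> \<rho>" "x \<in> F" "y \<in> F" for x y
      proof -
        have "(x, y) \<in> \<rho> \<inter> F \<times> F" using that by simp
        then show ?thesis unfolding \<rho>G by simp
      qed
      have "forces X xs t bs' (F - {x}) \<rho> us' q (Suc 2)"
        if "x \<in> {lo, hi}" "bs' \<noteq> []" "board X xs t bs' (F - {x}) us'" for x bs' us'
      proof -
        let ?y = "if x = lo then hi else lo"
        have "F - {x} = {lo', hi', ?y, e}" "distinct [lo', hi', ?y, e]" using G that(1) by auto
        moreover have "\<rho> \<inter> (F - {x}) \<times> (F - {x}) = {(lo', hi')}"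
        proof -
          have "\<rho> \<inter> (F - {x}) \<times> (F - {x}) = \<rho> \<inter> F \<times> F \<inter> (F - {x}) \<times> (F - {x})" by blast
          also have "\<dots> = {(lo', hi')}" unfolding \<rho>G using G that(1) by auto
          finally show ?thesis .
        qed
        ultimately have "forces X xs t bs' (F - {x}) \<rho> us' 0 3"
          by (rule forces_three_no_calls[OF that(3,2)])
        then show ?thesis unfolding q by (simp add: eval_nat_numeral)
      qed
      note rest = this
      show ?thesis
      proof (cases "lo \<in> negatives S \<or> positives S \<inter> F = {lo}")
        case True
        show ?thesis
          by (rule reply_bottom[OF *(1) bs *(3) _ _ True rest]) (use G \<rho>G' in auto)
      next
        case False
        with p have "hi \<in> positives S \<or> negatives S \<inter> F = {hi}" by auto
        then show ?thesis
          by (rule reply_top[OF *(1) bs *(3) _ _ _ rest, rotated 2]) (use G \<rho>G' in auto)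
      qed
    qed
    \<comment> \<open>If neither pair can pay, the positives avoid both highs and the negatives both
      lows. As \<open>e\<close> is not of both signs, one of the two sets also avoids
      \<open>e\<close> and consists of both lows or of both highs.\<close>
    consider "l1 \<in> negatives S \<or> h1 \<in> positives S \<or> positives S \<inter> F = {l1} \<or> negatives S \<inter> F = {h1}"
      | "l2 \<in> negatives S \<or> h2 \<in> positives S \<or> positives S \<inter> F = {l2} \<or> negatives S \<inter> F = {h2}"
      | "positives S \<inter> F = {l1, l2}" | "negatives S \<inter> F = {h1, h2}"
    proof -
      have two: "A \<subseteq> {a, b} \<Longrightarrow> A \<noteq> {} \<Longrightarrow> A \<noteq> {a} \<Longrightarrow> A \<noteq> {b} \<Longrightarrow> A = {a, b}" for A :: "'a set" and a b
        by blast
      have ne: "positives S \<inter> F \<noteq> {}" "negatives S \<inter> F \<noteq> {}" "positives S \<inter> negatives S = {}"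
        using *(3) by (auto simp: active_def)
      have "positives S \<inter> F = {l1, l2}" if "positives S \<inter> F \<noteq> {l1}" "positives S \<inter> F \<noteq> {l2}"
        "h1 \<notin> positives S" "h2 \<notin> positives S" "e \<notin> positives S"
        using that F(1) by (intro two ne) auto
      moreover have "negatives S \<inter> F = {h1, h2}" if "negatives S \<inter> F \<noteq> {h1}" "negatives S \<inter> F \<noteq> {h2}"
        "l1 \<notin> negatives S" "l2 \<notin> negatives S" "e \<notin> negatives S"
        using that F(1) by (intro two ne) auto
      moreover have "e \<notin> positives S \<or> e \<notin> negatives S" using ne(3) by auto
      ultimately show thesis using that by argo
    qed
    then show ?goal
    proof cases
      case 1
      then show ?thesis by (rule pair) (use F \<rho> in auto)
    next
      case 2
      then show ?thesis by (rule pair) (use F \<rho> in auto)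
    next
      case 3
      let ?F = "F - set [l1, l2]"
      let ?K = "states (bs @ [l1, l2]) (arrangements ?F \<rho>) us"
      have b: "set [l1, l2] \<subseteq> F" "distinct [l1, l2]" using F by auto
      have no: "(y, x) \<notin> \<rho>" if "x \<in> set [l1, l2]" "y \<in> F" for x y
        using \<rho>'[of y x] that F by auto
      have "sorted_wrt (\<lambda>x y. (y, x) \<notin> \<rho>) [l1, l2]" using no[of l1 l2] b(1) by simp
      then have sub: "?K \<subseteq> states bs (arrangements F \<rho>) us"
        by (rule bottom_subset[OF b]) (rule no, auto)
      have answer: "\<forall>(p, s) \<in> ?K. legal_answer (p @ s) S (Some (\<lambda>x. x \<in> set bs \<union> {l1, l2}))"
      proof (rule answer_below[OF *(3) disj(1) _ _ _ _ disj(2,3) bs])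
        show "negatives S \<inter> {l1, l2} = {}" using 3 PN by blast
      qed (use 3 b in auto)
      have free: "forces X xs t (bs @ [l1, l2]) ?F {} us q (Suc 2)"
        using F q by (intro forces_antichain board_bottom[OF *(1) b]) auto
      have "(x, y) \<notin> \<rho>" if "x \<in> ?F" "y \<in> ?F" for x y
        using \<rho>'[of x y] that by auto
      then have "\<rho> \<inter> ?F \<times> ?F = {} \<inter> ?F \<times> ?F" by blast
      from forces_cong[OF free this] have "forcing X xs ?K t q (Suc 2)" .
      with sub answer show ?thesis by blast
    next
      case 4
      let ?F = "F - set [h1, h2]"
      let ?K = "states bs (arrangements ?F \<rho>) ([h1, h2] @ us)"
      have b: "set [h1, h2] \<subseteq> F" "distinct [h1, h2]" using F by auto
      have no: "(x, y) \<notin> \<rho>" if "x \<in> set [h1, h2]" "y \<in> F" for x y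
        using \<rho>'[of x y] that F by auto
      have "sorted_wrt (\<lambda>x y. (y, x) \<notin> \<rho>) [h1, h2]" using no[of h2 h1] b(1) by simp
      then have sub: "?K \<subseteq> states bs (arrangements F \<rho>) us"
        by (rule top_subset[OF b]) (rule no, auto)
      have answer: "\<forall>(p, s) \<in> ?K. legal_answer (p @ s) S (Some (\<lambda>x. x \<in> set bs \<union> ?F))"
      proof (rule answer_above[OF *(3) disj(1) _ _ _ _ disj(2,3) bs])
        show "positives S \<inter> F \<subseteq> ?F" using 4 PN by auto
        show "negatives S \<inter> ?F = {}" using 4 by auto
      qed (auto simp: arrangements_def)
      have free: "forces X xs t bs ?F {} ([h1, h2] @ us) q (Suc 2)"
        using F q bs by (intro forces_antichain board_top[OF *(1) b]) auto
      have "(x, y) \<notin> \<rho>" if "x \<in> ?F" "y \<in> ?F" for x y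
        using \<rho>'[of x y] that by auto
      then have "\<rho> \<inter> ?F \<times> ?F = {} \<inter> ?F \<times> ?F" by blast
      from forces_cong[OF free this] have "forcing X xs ?K t q (Suc 2)" .
      with sub answer show ?thesis by blast
    qed
  qed (use F in auto)
  then show ?thesis by (simp add: eval_nat_numeral)
qed

lemma arrangements_mono: "\<rho> \<subseteq> \<rho>' \<Longrightarrow> arrangements F \<rho>' \<subseteq> arrangements F \<rho>"
  unfolding arrangements_def by (auto elim!: sorted_wrt_mono_rel[rotated])

lemma reply_related:
  assumes board: "board X xs t bs F us" and x: "x \<in> positives S" "n \<in> negatives S" "x \<in> F" "n \<in> F" "x \<noteq> n"
    and rest: "forces X xs t bs F (insert (n, x) \<rho>) us q m"
  shows "\<exists>a. \<exists>K \<subseteq> states bs (arrangements F \<rho>) us. (\<forall>(p, s) \<in> K. legal_answer (p @ s) S a) \<and>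
    forcing X xs K t q m"
proof -
  have "states bs (arrangements F (insert (n, x) \<rho>)) us \<subseteq> states bs (arrangements F \<rho>) us"
    using arrangements_mono[of \<rho> "insert (n, x) \<rho>" F]
      states_mono[of _ "[]" "[]" "arrangements F \<rho>" bs us] by auto
  moreover have "F \<inter> set bs = {}" using board by (auto simp: board_def)
  from answer_related[OF x _ this, of "insert (n, x) \<rho>" us]
  have "\<forall>(p, s) \<in> states bs (arrangements F (insert (n, x) \<rho>)) us. legal_answer (p @ s) S None"
    by simp
  ultimately show ?thesis using rest by blast
qed

text \<open>If a call can be paid with \<open>lo\<close> or \<open>hi\<close>, four incomparable
  elements and at most one call remain, still worth three mistakes. Otherwise \<open>G\<close>
  contains a positive and a negative example, and a second comparison, disjoint from the first, is
  the reply.\<close>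

lemma forces_three_two_calls:
  assumes board: "board X xs t bs F us" and bs: "bs \<noteq> []"
    and F: "F = insert lo (insert hi G)" "lo \<noteq> hi" "lo \<notin> G" "hi \<notin> G" "card G = 3"
    and \<rho>: "\<rho> \<inter> F \<times> F = {(lo, hi)}" and q: "q \<le> 2"
  shows "forces X xs t bs F \<rho> us q 3"
proof -
  have \<rho>': "(x, y) = (lo, hi)" if "(x, y) \<in> \<rho>" "x \<in> F" "y \<in> F" for x y
  proof -
    have "(x, y) \<in> \<rho> \<inter> F \<times> F" using that by simp
    then show ?thesis unfolding \<rho> by simp
  qed
  have G: "finite G" using F(5) by (intro card_ge_0_finite) simp
  have card: "card F = 5" using F G by simp
  have card1: "card (F - {x}) = 4" if "x \<in> F" for x using card that by (simp add: card_ge_0_finite)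
  have "forces X xs t bs F \<rho> us q (Suc 2)"
  proof (rule forces_SucI[OF board bs _ q])
    fix t q y
    assume *: "board X xs t bs F us" "t < length xs" "xs ! t \<in> F" "q \<le> (2::nat)"
    show "\<exists>K \<subseteq> states bs (arrangements F \<rho>) us. (\<forall>(p, s) \<in> K. xs ! t \<in> set p \<longleftrightarrow> y) \<and>
      forcing X xs K (Suc t) q 2"
    proof (cases "xs ! t \<in> {lo, hi}")
      case True
      have FG: "F - {lo, hi} = G" using F by auto
      show ?thesis
      proof (rule predict_pair[OF *(1) bs *(2) True])
        show "forces X xs (Suc t) bs' (F - {xs ! t}) \<rho> us' q 2"
          if "bs' \<noteq> []" "board X xs (Suc t) bs' (F - {xs ! t}) us'" for bs' us'
        proof (rule forces_two_antichain[OF that(2,1)])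
          show "3 \<le> card (F - {xs ! t})" using card1[OF *(3)] by simp
          fix x y assume "(x, y) \<in> \<rho>" "x \<in> F - {xs ! t}" "y \<in> F - {xs ! t}"
          with \<rho>'[of x y] True show False by auto
        qed
        show "forces X xs (Suc t) bs' (F - {lo, hi}) \<rho> us' q 2"
          if "bs' \<noteq> []" "board X xs (Suc t) bs' (F - {lo, hi}) us'" for bs' us'
        proof (rule forces_two_antichain[OF that(2,1)])
          show "3 \<le> card (F - {lo, hi})" using FG F(5) by simp
          fix x y assume "(x, y) \<in> \<rho>" "x \<in> F - {lo, hi}" "y \<in> F - {lo, hi}"
          with \<rho>'[of x y] show False by auto
        qed
      next
        show "lo \<in> F" "hi \<in> F" "lo \<noteq> hi" using F by auto
      qed (rule \<rho>')
    next
      case False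
      then have x: "xs ! t \<in> G" using *(3) F by auto
      then have "card (G - {xs ! t}) = 2" using F(5) G by simp
      then have "G - {xs ! t} \<noteq> {}" by (metis card.empty zero_neq_numeral)
      then obtain g where g: "g \<in> G" "g \<noteq> xs ! t" by blast
      have "g \<noteq> lo" "g \<noteq> hi" using g F(3,4) by auto
      then have sub: "{lo, hi, g} \<subseteq> F - {xs ! t}" "card {lo, hi, g} = 3"
        using g False F(1,2) by auto
      show ?thesis
      proof (rule predict_single[OF *(1) bs *(2,3)])
        show "(xs ! t, y) \<notin> \<rho> \<and> (y, xs ! t) \<notin> \<rho>" if "y \<in> F" for y
          using \<rho>'[of "xs ! t" y] \<rho>'[of y "xs ! t"] that *(3) False by auto
        show "forces X xs (Suc t) bs' (F - {xs ! t}) \<rho> us' q 2"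
          if "bs' \<noteq> []" "board X xs (Suc t) bs' (F - {xs ! t}) us'" for bs' us'
          by (rule forces_two[OF that(2,1) F(2) sub]) (use \<rho>' in auto)
      qed
    qed
  next
    fix t q S
    assume *: "board X xs t bs F us" "q < (2::nat)" "active bs F us S"
    let ?goal = "\<exists>a. \<exists>K \<subseteq> states bs (arrangements F \<rho>) us.
      (\<forall>(p, s) \<in> K. legal_answer (p @ s) S a) \<and> forcing X xs K t q (Suc 2)"
    have rest: "forces X xs t bs' (F - {x}) \<rho> us' q (Suc 2)"
      if "x \<in> {lo, hi}" "bs' \<noteq> []" "board X xs t bs' (F - {x}) us'" for x bs' us'
    proof -
      have "x \<in> F" using that(1) F by auto
      then have "forces X xs t bs' (F - {x}) {} us' q (Suc 2)"
        using *(2) card1 by (intro forces_antichain[OF that(3,2)]) simp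
      moreover have "(u, v) \<notin> \<rho>" if "u \<in> F - {x}" "v \<in> F - {x}" for u v
        using \<rho>'[of u v] that \<open>x \<in> {lo, hi}\<close> by auto
      then have "\<rho> \<inter> (F - {x}) \<times> (F - {x}) = {} \<inter> (F - {x}) \<times> (F - {x})" by blast
      ultimately show ?thesis by (rule forces_cong)
    qed
    consider "lo \<in> negatives S \<or> positives S \<inter> F = {lo}" | "hi \<in> positives S \<or> negatives S \<inter> F = {hi}"
      | n p where "p \<in> positives S" "p \<in> G" "n \<in> negatives S" "n \<in> G"
    proof -
      have ne: "positives S \<inter> F \<noteq> {}" "negatives S \<inter> F \<noteq> {}" using *(3) by (auto simp: active_def)
      have "\<exists>p. p \<in> positives S \<and> p \<in> G" if "hi \<notin> positives S" "positives S \<inter> F \<noteq> {lo}"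
        using that ne(1) F(1) by auto
      moreover have "\<exists>n. n \<in> negatives S \<and> n \<in> G" if "lo \<notin> negatives S" "negatives S \<inter> F \<noteq> {hi}"
        using that ne(2) F(1) by auto
      ultimately show thesis using that by metis
    qed
    then show ?goal
    proof cases
      case 1
      show ?thesis
      proof (rule reply_bottom[OF *(1) bs *(3) _ _ 1 rest])
        show lo: "lo \<in> F" "lo \<in> {lo, hi}" using F(1) by auto
        show "(y, lo) \<notin> \<rho>" if "y \<in> F" for y using \<rho>'[of y lo] that lo F(2) by auto
      qed
    next
      case 2
      show ?thesis
      proof (rule reply_top[OF *(1) bs *(3) _ _ 2 rest])
        show hi: "hi \<in> F" "hi \<in> {lo, hi}" using F(1) by auto
        show "(hi, y) \<notin> \<rho>" if "y \<in> F" for y using \<rho>'[of hi y] that hi F(2) by auto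
      qed
    next
      case (3 n p)
      have np: "p \<noteq> n" using 3 *(3) by (auto simp: active_def)
      then have "card (G - {n, p}) = 1" using 3 F(5) G by (simp add: card_Diff_subset)
      then obtain e where "G - {n, p} = {e}" by (rule card_1_singletonE)
      then have "G = {n, p, e}" "e \<noteq> n" "e \<noteq> p" using 3 by auto
      then have F': "F = {lo, hi, n, p, e}" "distinct [lo, hi, n, p, e]" using F np by auto
      have "insert (n, p) \<rho> \<inter> F \<times> F = insert (n, p) (\<rho> \<inter> F \<times> F)" using 3 F by auto
      then have "insert (n, p) \<rho> \<inter> F \<times> F = {(lo, hi), (n, p)}" using \<rho> by auto
      from forces_three_one_call[OF *(1) bs F' this, of q] *(2)
      have "forces X xs t bs F (insert (n, p) \<rho>) us q (Suc 2)" by (simp add: eval_nat_numeral)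
      then show ?thesis using 3 F np by (intro reply_related[OF *(1)]) auto
    qed
  qed (use F in auto)
  then show ?thesis by (simp add: eval_nat_numeral)
qed

text \<open>Paying all three calls with elements would leave two mistakes, so the first active call
  is paid with a comparison between one of its negative and one of its positive examples.\<close>

lemma forces_three_three_calls:
  assumes board: "board X xs t bs F us" and bs: "bs \<noteq> []" and card: "card F = 5" and q: "q \<le> 3"
  shows "forces X xs t bs F {} us q 3"
proof -
  have fin: "finite F" using board by (simp add: board_def)
  have "forces X xs t bs F {} us q (Suc 2)"
  proof (rule forces_SucI[OF board bs _ q])
    fix t q y
    assume *: "board X xs t bs F us" "t < length xs" "xs ! t \<in> F" "q \<le> (3::nat)"
    have "3 \<le> card (F - {xs ! t})" using card fin *(3) by simp
    then show "\<exists>K \<subseteq> states bs (arrangements F {}) us. (\<forall>(p, s) \<in> K. xs ! t \<in> set p \<longleftrightarrow> y) \<and>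
      forcing X xs K (Suc t) q 2"
      by (intro predict_single[OF *(1) bs *(2,3)] forces_two_antichain) auto
  next
    fix t q S
    assume *: "board X xs t bs F us" "q < (3::nat)" "active bs F us S"
    then obtain n p where np: "p \<in> positives S" "p \<in> F" "n \<in> negatives S" "n \<in> F" "p \<noteq> n"
      unfolding active_def by blast
    have "card (F - {n, p}) = 3" using np card fin by (simp add: card_Diff_subset)
    moreover have "F = insert n (insert p (F - {n, p}))" using np by auto
    ultimately have "forces X xs t bs F {(n, p)} us q 3"
      using np *(2) by (intro forces_three_two_calls[OF *(1) bs]) auto
    then have "forces X xs t bs F {(n, p)} us q (Suc 2)" by (simp add: eval_nat_numeral)
    then show "\<exists>a. \<exists>K \<subseteq> states bs (arrangements F {}) us.
      (\<forall>(p, s) \<in> K. legal_answer (p @ s) S a) \<and> forcing X xs K t q (Suc 2)"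
      using np by (intro reply_related[OF *(1)]) auto
  qed (use card in auto)
  then show ?thesis by (simp add: eval_nat_numeral)
qed

text \<open>Without a sentinel, the first call may be answered by revealing the minimum \<open>x\<close> only.\<close>

lemma forcing_unknown_minimum:
  assumes board: "board X xs t [] F us" and t: "t < length xs" "xs ! t \<in> F"
    and one: "board X xs (Suc t) [xs ! t] (F - {xs ! t}) us \<Longrightarrow>
      forces X xs (Suc t) [xs ! t] (F - {xs ! t}) {} us q m"
    and zero: "board X xs (Suc t) [] (F - {xs ! t}) (xs ! t # us) \<Longrightarrow>
      forces X xs (Suc t) [] (F - {xs ! t}) {} (xs ! t # us) q m"
    and call: "\<And>x q'. x \<in> F \<Longrightarrow> q = Suc q' \<Longrightarrow> board X xs t [x] (F - {x}) us \<Longrightarrow>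
      forces X xs t [x] (F - {x}) {} us q' (Suc m)"
  shows "forces X xs t [] F {} us q (Suc m)"
proof (rule forcing.step[OF t(1)])
  let ?x = "xs ! t" and ?K = "states [] (arrangements F {}) us"
  have bottom: "states [x] (arrangements (F - {x}) {}) us \<subseteq> ?K" "board X xs t [x] (F - {x}) us"
    if "x \<in> F" for x
    using bottom_subset[of "[x]" F "{}" "[]" us] board_bottom[OF board, of "[x]"] that by auto
  {
    fix b
    \<comment> \<open>Label 1 makes the current instance the minimum; label 0 puts it on top and
      leaves the minimum unknown.\<close>
    let ?K' = "if b then states [] (arrangements (F - {?x}) {}) (?x # us)
      else states [?x] (arrangements (F - {?x}) {}) us"
    have "?K' \<subseteq> ?K"
      using top_subset[of "[?x]" F "{}" "[]" us] bottom(1) t(2) by auto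
    moreover have "\<forall>(p, s) \<in> ?K'. ?x \<in> set p \<longleftrightarrow> \<not> b"
      by (auto simp: arrangements_def dest: label_bottom label_top)
    moreover have "board X xs (Suc t) [?x] (F - {?x}) us"
      using bottom(2)[OF t(2)] t(1) by (intro board_Suc) auto
    moreover have "board X xs (Suc t) [] (F - {?x}) (?x # us)"
      using board_top[OF board, of "[?x]"] t by (intro board_Suc) auto
    ultimately show "\<exists>y K' m'. K' \<subseteq> ?K \<and> (\<forall>(p, s) \<in> K'. ?x \<in> set p \<longleftrightarrow> y) \<and>
        Suc m \<le> m' + (if b = y then 0 else 1) \<and> forcing X xs K' (Suc t) q m'"
      using one zero by (intro exI[of _ "\<not> b"] exI[of _ ?K'] exI[of _ m]) auto
  next
    fix q' and S :: "'a sample" assume q: "q = Suc q'" and S: "S \<subseteq> X \<times> UNIV"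
    \<comment> \<open>A negative example as minimum, or any element if \<open>F\<close> contains
      none, renders the call inactive.\<close>
    obtain x where x: "x \<in> F" "\<not> active [x] (F - {x}) us S"
    proof (cases "negatives S \<inter> F = {}")
      case True
      with t(2) show thesis by (intro that[of ?x]) (auto simp: active_def)
    next
      case False
      then obtain x where "x \<in> negatives S" "x \<in> F" by blast
      moreover have "x \<notin> set us" using board \<open>x \<in> F\<close> by (auto simp: board_def)
      ultimately show thesis by (intro that[of x]) (auto simp: active_def)
    qed
    let ?K' = "states [x] (arrangements (F - {x}) {}) us"
    from inactive_answer[OF bottom(2)[OF x(1)] _ S x(2)] obtain a where
      a: "distinct fs \<and> set fs = F - {x} \<Longrightarrow> legal_answer ([x] @ fs @ us) S a" for fs by blast
    have "\<forall>(p, s) \<in> ?K'. legal_answer (p @ s) S a"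
    proof clarify
      fix p s assume "(p, s) \<in> ?K'"
      then obtain fs where "fs \<in> arrangements (F - {x}) {}" "p @ s = [x] @ fs @ us"
        by (rule states_append)
      with a[of fs] show "legal_answer (p @ s) S a" by (simp add: arrangements_def)
    qed
    with bottom[OF x(1)] call[OF x(1) q] show "\<exists>a K'. K' \<subseteq> ?K \<and>
        (\<forall>(p, s) \<in> K'. legal_answer (p @ s) S a) \<and> forcing X xs K' t q' (Suc m)" by blast
  }
qed

text \<open>One element has to end up as the minimum, with or without calls, and the first call
  costs no more than that. Hence \<open>max 1 q\<close> in place of \<open>q\<close>.\<close>

lemma forces_antichain_unknown_minimum:
  assumes "distinct xs"
  shows "board X xs t [] (set (drop t xs)) us \<Longrightarrow> m + max 1 q \<le> length xs - t \<Longrightarrow>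
    forces X xs t [] (set (drop t xs)) {} us q m"
proof (induction m arbitrary: t us)
  case 0
  then have "drop t xs \<noteq> []" by auto
  moreover have "drop t xs \<in> arrangements (set (drop t xs)) {}"
    using assms by (simp add: arrangements_def sorted_wrt_true)
  ultimately have "(drop t xs, us) \<in> states [] (arrangements (set (drop t xs)) {}) us"
    unfolding states_def by (intro CollectI exI[of _ "drop t xs"] exI[of _ "[]"]) simp
  then have "states [] (arrangements (set (drop t xs)) {}) us \<noteq> {}" by blast
  then show ?case by (rule forcing.none)
next
  case (Suc m)
  let ?F = "set (drop t xs)" and ?x = "xs ! t"
  have t: "t < length xs" using Suc.prems(2) by simp
  have F: "?F - {?x} = set (drop (Suc t) xs)" "?x \<in> ?F"
    using Cons_nth_drop_Suc[OF t, symmetric] assms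
    by (auto simp: distinct_drop dest: distinct_drop[of xs t])
  have card: "card ?F = length xs - t" using assms by (simp add: distinct_card)
  show ?case
  proof (rule forcing_unknown_minimum[OF Suc.prems(1) t F(2)])
    show "forces X xs (Suc t) [?x] (?F - {?x}) {} us q m"
      if "board X xs (Suc t) [?x] (?F - {?x}) us"
      using Suc.prems(2) card F(2) by (intro forces_antichain[OF that]) auto
    show "forces X xs (Suc t) [] (?F - {?x}) {} (?x # us) q m"
      if "board X xs (Suc t) [] (?F - {?x}) (?x # us)"
      using Suc.prems(2) that unfolding F(1) by (intro Suc.IH) auto
    show "forces X xs t [x] (?F - {x}) {} us q' (Suc m)"
      if "x \<in> ?F" "q = Suc q'" "board X xs t [x] (?F - {x}) us" for x q'
      using Suc.prems(2) card that(1,2) by (intro forces_antichain[OF that(3)]) auto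
  qed
qed

text \<open>A first call reveals the minimum only and leaves five elements with three calls, the
  position of \<open>forces_three_three_calls\<close>. After a first prediction enough elements
  remain for a tree of depth two.\<close>

lemma forces_three_unknown_minimum:
  assumes "distinct xs" and xs: "length xs = 6" and board: "board X xs 0 [] (set xs) []"
  shows "forces X xs 0 [] (set xs) {} [] 4 3"
proof -
  let ?x = "xs ! 0"
  have card: "card (set xs) = 6" using assms by (simp add: distinct_card)
  have x: "0 < length xs" "?x \<in> set xs" using xs by auto
  have "forces X xs 0 [] (set xs) {} [] 4 (Suc 2)"
  proof (rule forcing_unknown_minimum[OF board x])
    show "forces X xs (Suc 0) [?x] (set xs - {?x}) {} [] 4 2"
      if "board X xs (Suc 0) [?x] (set xs - {?x}) []"
      using card x by (intro forces_two_antichain[OF that]) auto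
    show "forces X xs (Suc 0) [] (set xs - {?x}) {} [?x] 4 2"
      if b: "board X xs (Suc 0) [] (set xs - {?x}) [?x]"
    proof -
      have card': "card (set xs - {?x}) = 5" using card x by simp
      \<comment> \<open>Any element may now be declared the minimum: four free ones remain, and
        three suffice.\<close>
      then have "set xs - {?x} \<noteq> {}" by (metis card.empty zero_neq_numeral)
      then obtain z where z: "z \<in> set xs - {?x}" by blast
      let ?F = "set xs - {?x} - {z}"
      have "board X xs (Suc 0) [z] ?F [?x]"
        using board_bottom[OF b, of "[z]"] z by auto
      then have "forces X xs (Suc 0) [z] ?F {} [?x] 4 2"
        using card' z by (intro forces_two_antichain) auto
      moreover have "states [z] (arrangements ?F {}) [?x]
          \<subseteq> states [] (arrangements (set xs - {?x}) {}) [?x]"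
        using bottom_subset[of "[z]" "set xs - {?x}" "{}" "[]" "[?x]"] z by auto
      ultimately show ?thesis by (rule forcing_mono)
    qed
    show "forces X xs 0 [x] (set xs - {x}) {} [] q' (Suc 2)"
      if "x \<in> set xs" "4 = Suc q'" "board X xs 0 [x] (set xs - {x}) []" for x q'
      using forces_three_three_calls[OF that(3)] card that(1,2) by (simp add: eval_nat_numeral)
  qed
  then show ?thesis by (simp add: eval_nat_numeral)
qed

subsection \<open>The minimax values\<close>

lemma instances_nonempty:
  assumes "r \<in> R" "z \<in> X" shows "instances X R \<noteq> {}"
proof -
  define A where "A S = (if \<exists>c \<in> concept_class X r. consistent c S
    then Some (SOME c. c \<in> concept_class X r \<and> consistent c S) else None)" for S
  have "\<exists>c \<in> concept_class X r. consistent c S \<and> A S = Some c"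
    if "\<exists>c \<in> concept_class X r. consistent c S" for S
    using someI_ex[of "\<lambda>c. c \<in> concept_class X r \<and> consistent c S"] that by (auto simp: A_def)
  then have "legal_erm X r A" by (auto simp: legal_erm_def A_def)
  with assms show ?thesis by (auto simp: instances_def)
qed

abbreviation orders_E :: "nat \<Rightarrow> nat rel set" where
  "orders_E T \<equiv> {r. linear_order_on {0..T} r \<and> (\<forall>x \<in> {0..T}. (0, x) \<in> r)}"

abbreviation orders_N :: "nat \<Rightarrow> nat rel set" where
  "orders_N T \<equiv> {r. linear_order_on {1..T} r}"

lemma list_order_hd:
  assumes "x \<in> set l" shows "(hd l, x) \<in> list_order l"
proof -
  obtain j where "j < length l" "x = l ! j" using assms by (auto simp: in_set_conv_nth)
  moreover have "hd l = l ! 0" using assms by (intro hd_conv_nth) auto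
  ultimately show ?thesis unfolding list_order_def by blast
qed

lemma list_order_E:
  assumes "distinct l" "set l = {0..T}" "hd l = 0" shows "list_order l \<in> orders_E T"
  using linear_order_list_order[OF assms(1)] list_order_hd[of _ l] assms by auto

lemma list_order_N: "distinct l \<Longrightarrow> set l = {1..T} \<Longrightarrow> list_order l \<in> orders_N T"
  using linear_order_list_order[of l] by auto

lemma instances_E_nonempty: "instances {0..T} (orders_E T) \<noteq> {}"
proof (rule instances_nonempty)
  show "list_order [0..<Suc T] \<in> orders_E T" by (rule list_order_E) (auto simp del: upt_Suc)
  show "0 \<in> {0..T}" by simp
qed

lemma instances_N_nonempty:
  assumes "T \<ge> 1" shows "instances {1..T} (orders_N T) \<noteq> {}"
proof (rule instances_nonempty)
  show "list_order [1..<Suc T] \<in> orders_N T" by (rule list_order_N) (auto simp del: upt_Suc)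
  show "1 \<in> {1..T}" using assms by simp
qed

lemma M_E_ge:
  assumes "forces {0..T} [1..<Suc T] 0 [0] {1..T} {} [] Q m" shows "m \<le> M_E T Q"
  unfolding M_E_def
proof (rule minimax_ge_if_forcing[OF instances_E_nonempty _ assms])
  show "states [0] (arrangements {1..T} {}) []
    \<subseteq> {(p, s). p \<noteq> [] \<and> distinct (p @ s) \<and> set (p @ s) = {0..T} \<and> list_order (p @ s) \<in> orders_E T}"
  proof (rule subrelI)
    fix p s assume ps: "(p, s) \<in> states [0] (arrangements {1..T} {}) []"
    then have "p \<noteq> []" by (auto simp: states_def)
    moreover from ps obtain fs where "fs \<in> arrangements {1..T} {}" "p @ s = 0 # fs"
      by (auto elim: states_append)
    then have "distinct (p @ s)" "set (p @ s) = {0..T}" "hd (p @ s) = 0"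
      by (auto simp del: distinct_append set_append simp: arrangements_def)
    moreover from this have "list_order (p @ s) \<in> orders_E T" by (rule list_order_E)
    ultimately show "(p, s) \<in> {(p, s). p \<noteq> [] \<and> distinct (p @ s) \<and> set (p @ s) = {0..T} \<and>
        list_order (p @ s) \<in> orders_E T}" by blast
  qed
qed

lemma M_N_ge:
  assumes "T \<ge> 1" "forces {1..T} [1..<Suc T] 0 [] {1..T} {} [] Q m" shows "m \<le> M_N T Q"
  unfolding M_N_def
proof (rule minimax_ge_if_forcing[OF instances_N_nonempty[OF assms(1)] _ assms(2)])
  show "states [] (arrangements {1..T} {}) []
    \<subseteq> {(p, s). p \<noteq> [] \<and> distinct (p @ s) \<and> set (p @ s) = {1..T} \<and> list_order (p @ s) \<in> orders_N T}"
  proof (rule subrelI)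
    fix p s assume ps: "(p, s) \<in> states [] (arrangements {1..T} {}) []"
    then have "p \<noteq> []" by (auto simp: states_def)
    moreover from ps obtain fs where "fs \<in> arrangements {1..T} {}" "p @ s = fs"
      by (auto elim: states_append)
    then have "distinct (p @ s)" "set (p @ s) = {1..T}"
      by (auto simp del: distinct_append set_append simp: arrangements_def)
    moreover from this have "list_order (p @ s) \<in> orders_N T" by (rule list_order_N)
    ultimately show "(p, s) \<in> {(p, s). p \<noteq> [] \<and> distinct (p @ s) \<and> set (p @ s) = {1..T} \<and>
        list_order (p @ s) \<in> orders_N T}" by blast
  qed
qed

lemma board_E: "board {0..T} [1..<Suc T] 0 [0] {1..T} []"
  by (auto simp: board_def simp del: upt_Suc)

lemma board_N: "board {1..T} [1..<Suc T] 0 [] {1..T} []"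
  by (auto simp: board_def simp del: upt_Suc)

lemma M_E_ge_diff: "T - Q \<le> M_E T Q"
proof (cases "Q \<le> T")
  case True
  then show ?thesis by (intro M_E_ge forces_antichain[OF board_E]) auto
qed simp

lemma M_E_ge_log:
  assumes "2 ^ d \<le> T + 1" shows "d \<le> M_E T Q"
proof (rule M_E_ge, rule forces_log[OF board_E])
  show "{1..2 ^ d - 1} \<subseteq> {1..T}" using assms by auto
  show "(0::nat) \<noteq> 1" by simp
qed auto

lemma M_E_5_3_ge: "3 \<le> M_E 5 3"
  by (intro M_E_ge forces_three_three_calls[OF board_E]) auto

lemma M_N_ge_diff:
  assumes "T \<ge> 1" shows "T - max 1 Q \<le> M_N T Q"
proof (cases "Q \<le> T")
  case True
  have "forces {1..T} [1..<Suc T] 0 [] (set (drop 0 [1..<Suc T])) {} [] Q (T - max 1 Q)"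
    by (rule forces_antichain_unknown_minimum) (use board_N[of T] True assms in \<open>auto simp del: upt_Suc simp: atLeastLessThanSuc_atLeastAtMost\<close>)
  then show ?thesis
    by (intro M_N_ge[OF assms]) (simp add: atLeastLessThanSuc_atLeastAtMost del: upt_Suc)
qed simp

lemma M_N_ge_log:
  assumes "T \<ge> 1" "2 ^ d \<le> T" shows "d \<le> M_N T Q"
proof (rule M_N_ge[OF assms(1)])
  \<comment> \<open>The instance \<open>T\<close> is spent as the minimum, so the
    \<open>2 ^ d - 1\<close> nodes of the tree are taken from the other \<open>T - 1\<close>
    instances.\<close>
  let ?F = "{1..T} - set [T]"
  have board: "board {1..T} [1..<Suc T] 0 [T] ?F []"
    using board_bottom[OF board_N[of T], of "[T]"] assms(1) by simp
  have "forces {1..T} [1..<Suc T] 0 [T] ?F {} [] Q d"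
  proof (rule forces_log[OF board])
    show "{1..2 ^ d - 1} \<subseteq> ?F" using assms by (auto simp: le_diff_conv2)
    show "(0::nat) \<noteq> 1" by simp
  qed auto
  moreover have "states [T] (arrangements ?F {}) [] \<subseteq> states [] (arrangements {1..T} {}) []"
    using bottom_subset[of "[T]" "{1..T}" "{}" "[]" "[]"] assms(1) by simp
  ultimately show "forces {1..T} [1..<Suc T] 0 [] {1..T} {} [] Q d" by (rule forcing_mono)
qed

lemma M_N_6_4_ge: "3 \<le> M_N 6 4"
proof -
  have set: "set [1..<Suc 6] = {1..6}" by auto
  have "forces {1..6} [1..<Suc 6] 0 [] {1..6} {} [] 4 3"
    using forces_three_unknown_minimum[of "[1..<Suc 6]" "{1..6}"] board_N[of 6] unfolding set
    by (simp del: upt_Suc)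
  then show ?thesis by (intro M_N_ge) auto
qed

lemma M_E_le_pairs: "T \<le> Q + m \<Longrightarrow> T \<le> 2 * m \<Longrightarrow> M_E T Q \<le> m"
  unfolding M_E_def
  by (intro minimax_le_if_solvable instances_E_nonempty solvable_pairs[of "orders_E T"])
    (auto simp del: upt_Suc)

lemma M_N_le_pairs: "T \<ge> 1 \<Longrightarrow> T \<le> Q + m \<Longrightarrow> T \<le> 2 * m \<Longrightarrow> M_N T Q \<le> m"
  unfolding M_N_def
  by (intro minimax_le_if_solvable instances_N_nonempty solvable_pairs[of "orders_N T"])
    (auto simp del: upt_Suc)

lemma M_N_le:
  assumes "T \<ge> 1" shows "M_N T Q \<le> T - 1"
proof -
  have "solvable {1..T} [1..<Suc T] (instances {1..T} (orders_N T)) 0 Q (length [1..<Suc T] - 1)"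
  proof (rule solvable_nonempty_label)
    fix i assume i: "i \<in> instances {1..T} (orders_N T)"
    then have "linear_order_on {1..T} (fst i)" "fst (snd i) \<in> {1..T}" by (auto simp: instances_def)
    then have "target i (fst (snd i))" "fst (snd i) \<in> set [1..<Suc T]"
      by (auto simp: threshold_def order_on_defs refl_on_def simp del: upt_Suc)
    then show "\<exists>x \<in> set [1..<Suc T]. target i x" by blast
  qed (use assms in auto)
  then show ?thesis
    unfolding M_N_def using minimax_le_if_solvable[OF instances_N_nonempty[OF assms]]
    by (simp del: upt_Suc)
qed

text \<open>The sentinel alone is an initial segment known in advance. It gives two signatures among
  \<open>T + 1\<close> elements at the start, so \<open>T - 1\<close> further segments at two calls
  each suffice.\<close>

lemma M_E_le_sorting:
  assumes "T \<ge> 1" "2 * (T - 1) \<le> Q" "T + 1 < 2 ^ Suc m" shows "M_E T Q \<le> m"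
  unfolding M_E_def
proof (intro minimax_le_if_solvable instances_E_nonempty
    solvable_sorting[of "orders_E T" _ _ "{{0}}"])
  show "\<forall>i \<in> instances {0..T} (orders_E T). \<forall>D \<in> {{0}}. \<forall>x \<in> D. \<forall>y. (y, x) \<in> fst i \<longrightarrow> y \<in> D"
  proof clarify
    fix r z A y assume i: "(r, z, A) \<in> instances {0..T} (orders_E T)" and y: "(y, 0) \<in> fst (r, z, A)"
    then have "linear_order_on {0..T} r" "\<forall>x \<in> {0..T}. (0, x) \<in> r" by (auto simp: instances_def)
    moreover from this y have "y \<in> {0..T}" by (auto simp: order_on_defs refl_on_def)
    ultimately show "y = 0" using y unfolding order_on_defs antisym_def by auto
  qed
  let ?sig = "\<lambda>x :: nat. {D \<in> {{0}}. x \<in> D}"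
  have "{{0}} \<in> ?sig ` {0..T}" by (rule image_eqI[of _ _ 0]) auto
  moreover have "{} \<in> ?sig ` {0..T}" by (rule image_eqI[of _ _ 1]) (use assms(1) in auto)
  ultimately have "{{{0}}, {}} \<subseteq> ?sig ` {0..T}" by blast
  then have "card {{{0::nat}}, {}} \<le> card ((\<lambda>x. {D \<in> {{0}}. x \<in> D}) ` {0..T})"
    by (intro card_mono) auto
  then have "2 \<le> card ((\<lambda>x. {D \<in> {{0}}. x \<in> D}) ` {0..T})" by simp
  with assms(2) show "2 * (card {0..T} - card ((\<lambda>x. {D \<in> {{0}}. x \<in> D}) ` {0..T})) \<le> Q"
    unfolding card_atLeastAtMost by linarith
qed (use assms in auto)

text \<open>No segment is known at the start, but there are only \<open>T\<close> elements; from one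
  signature on, \<open>T - 1\<close> segments are again enough.\<close>

lemma M_N_le_sorting:
  assumes "T \<ge> 1" "2 * (T - 1) \<le> Q" "T < 2 ^ Suc m" shows "M_N T Q \<le> m"
  unfolding M_N_def
proof (intro minimax_le_if_solvable instances_N_nonempty
    solvable_sorting[of "orders_N T" _ _ "{}"])
  have "(\<lambda>x. {D \<in> {}. x \<in> D}) ` {1..T} = {{}}" using assms(1) by auto
  then show "2 * (card {1..T} - card ((\<lambda>x. {D \<in> {}. x \<in> D}) ` {1..T})) \<le> Q"
    using assms by simp
qed (use assms in auto)

section \<open>Integer forms of the logarithms and halves, and assembly of the bounds\<close>

lemma floor_log2_eq: "2 ^ d \<le> n \<Longrightarrow> n < 2 ^ Suc d \<Longrightarrow> \<lfloor>log 2 (real n)\<rfloor> = int d"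
  using floor_log_nat_eq_if[of 2 d n] by simp

lemma floor_log2_nat:
  assumes "n \<ge> 1" obtains d where "2 ^ d \<le> n" "n < 2 ^ Suc d" "\<lfloor>log 2 (real n)\<rfloor> = int d"
proof -
  obtain d where "2 ^ d \<le> n" "n < 2 ^ Suc d" using ex_power_ivl1[of 2 n] assms by auto
  with floor_log2_eq that show thesis by blast
qed

lemma ceiling_half: "\<lceil>real T / 2\<rceil> = int ((T + 1) div 2)"
  by (rule ceiling_unique) (auto simp: field_simps; linarith)+

lemma floor_half: "\<lfloor>real T / 2\<rfloor> = int (T div 2)"
  using floor_divide_of_nat_eq[of T 2] by simp

theorem theorem7p1:
  shows
    "(\<comment> \<open>(i)\<close>
      (\<forall>T Q :: nat. T \<ge> 1 \<longrightarrow>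
         max (int T - int Q) \<lfloor>log 2 (real T + 1)\<rfloor> \<le> int (M_E T Q) \<and>
         int (M_E T Q) \<le> max (int T - int Q) \<lceil>real T / 2\<rceil>) \<and>
      (\<forall>T :: nat. T \<ge> 1 \<longrightarrow>
         int (M_N T 0) = int T - 1 \<and> int (M_N T 1) = int T - 1) \<and>
      (\<forall>T Q :: nat. T \<ge> 1 \<and> Q \<ge> 1 \<longrightarrow>
         max (int T - int Q) \<lfloor>log 2 (real T)\<rfloor> \<le> int (M_N T Q) \<and>
         int (M_N T Q) \<le> min (int T - 1) (max (int T - int Q) \<lceil>real T / 2\<rceil>))) \<and>
     (\<comment> \<open>(ii)\<close>
      (\<forall>T Q :: nat. T \<ge> 1 \<and> int Q \<le> \<lfloor>real T / 2\<rfloor> \<longrightarrow>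
         int (M_E T Q) = int T - int Q) \<and>
      (\<forall>T Q :: nat. T \<ge> 1 \<and> int Q \<ge> 2 * (int T - 1) \<longrightarrow>
         int (M_E T Q) = \<lfloor>log 2 (real T + 1)\<rfloor> \<and>
         int (M_N T Q) = \<lfloor>log 2 (real T)\<rfloor>) \<and>
      (\<exists>T Q :: nat. T \<ge> 1 \<and> int Q < 2 * (int T - 1) \<and>
         int (M_E T Q) = \<lfloor>log 2 (real T + 1)\<rfloor> \<and>
         int (M_N T Q) = \<lfloor>log 2 (real T)\<rfloor>)) \<and>
     (\<comment> \<open>(iii)\<close>
      M_E 5 3 = 3 \<and> M_N 6 4 = 3 \<and>
      max (5 - 3) \<lfloor>log 2 (5 + 1)\<rfloor> < int (M_E 5 3) \<and>
      max (6 - 4) \<lfloor>log 2 6\<rfloor> < int (M_N 6 4))"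
proof -
  have E_lower: "int T - int Q \<le> int (M_E T Q)" "\<lfloor>log 2 (real T + 1)\<rfloor> \<le> int (M_E T Q)" for T Q
  proof -
    show "int T - int Q \<le> int (M_E T Q)" using M_E_ge_diff[of T Q] by linarith
    obtain d where "2 ^ d \<le> T + 1" "\<lfloor>log 2 (real (T + 1))\<rfloor> = int d"
      using floor_log2_nat[of "T + 1"] by auto
    then show "\<lfloor>log 2 (real T + 1)\<rfloor> \<le> int (M_E T Q)" using M_E_ge_log[of d T Q] by (simp add: add.commute)
  qed
  have E_upper: "int (M_E T Q) \<le> max (int T - int Q) (int ((T + 1) div 2))" for T Q
  proof -
    have "M_E T Q \<le> max (T - Q) ((T + 1) div 2)" by (rule M_E_le_pairs) auto
    then show ?thesis by linarith
  qed
  \<comment> \<open>\<open>max 1 Q\<close> yields both \<open>T - 1\<close> for at most one call and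
    \<open>T - Q\<close> for \<open>Q \<ge> 1\<close>.\<close>
  have N_lower: "int T - int (max 1 Q) \<le> int (M_N T Q)" "\<lfloor>log 2 (real T)\<rfloor> \<le> int (M_N T Q)"
    if T: "T \<ge> 1" for T Q
  proof -
    show "int T - int (max 1 Q) \<le> int (M_N T Q)" using M_N_ge_diff[OF T, of Q] by linarith
    obtain d where "2 ^ d \<le> T" "\<lfloor>log 2 (real T)\<rfloor> = int d" using floor_log2_nat[OF T] by auto
    then show "\<lfloor>log 2 (real T)\<rfloor> \<le> int (M_N T Q)" using M_N_ge_log[OF T, of d Q] by simp
  qed
  have N_upper: "int (M_N T Q) \<le> int T - 1" "int (M_N T Q) \<le> max (int T - int Q) (int ((T + 1) div 2))"
    if T: "T \<ge> 1" for T Q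
  proof -
    show "int (M_N T Q) \<le> int T - 1" using M_N_le[OF T, of Q] T by linarith
    have "M_N T Q \<le> max (T - Q) ((T + 1) div 2)" by (rule M_N_le_pairs[OF T]) auto
    then show "int (M_N T Q) \<le> max (int T - int Q) (int ((T + 1) div 2))" by linarith
  qed
  have E_log: "int (M_E T Q) = \<lfloor>log 2 (real T + 1)\<rfloor>" if T: "T \<ge> 1" and Q: "int Q \<ge> 2 * (int T - 1)" for T Q
  proof -
    obtain d where "T + 1 < 2 ^ Suc d" "\<lfloor>log 2 (real (T + 1))\<rfloor> = int d"
      using floor_log2_nat[of "T + 1"] by auto
    moreover have "int (2 * (T - 1)) \<le> int Q" using T Q by (simp add: of_nat_diff)
    then have "2 * (T - 1) \<le> Q" by (simp only: of_nat_le_iff)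
    ultimately have "M_E T Q \<le> d" "\<lfloor>log 2 (real T + 1)\<rfloor> = int d"
      using M_E_le_sorting[OF T] by (auto simp: add.commute)
    with E_lower(2)[of T Q] show ?thesis by linarith
  qed
  have N_log: "int (M_N T Q) = \<lfloor>log 2 (real T)\<rfloor>" if T: "T \<ge> 1" and Q: "int Q \<ge> 2 * (int T - 1)" for T Q
  proof -
    obtain d where "T < 2 ^ Suc d" "\<lfloor>log 2 (real T)\<rfloor> = int d"
      using floor_log2_nat[OF T] by auto
    moreover have "int (2 * (T - 1)) \<le> int Q" using T Q by (simp add: of_nat_diff)
    then have "2 * (T - 1) \<le> Q" by (simp only: of_nat_le_iff)
    ultimately have "M_N T Q \<le> d" "\<lfloor>log 2 (real T)\<rfloor> = int d"
      using M_N_le_sorting[OF T] by auto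
    with N_lower(2)[OF T, of Q] show ?thesis by linarith
  qed
  have logs: "\<lfloor>log 2 (2 + 1 :: real)\<rfloor> = 1" "\<lfloor>log 2 (2 :: real)\<rfloor> = 1" "\<lfloor>log 2 (5 + 1 :: real)\<rfloor> = 2"
    "\<lfloor>log 2 (6 :: real)\<rfloor> = 2"
    using floor_log2_eq[of 1 3] floor_log2_eq[of 1 2] floor_log2_eq[of 2 6] by auto
  have E53: "M_E 5 3 = 3" using M_E_5_3_ge E_upper[of 5 3] by simp
  have N64: "M_N 6 4 = 3" using M_N_6_4_ge N_upper(2)[of 6 4] by simp
  \<comment> \<open>\<open>T = 2\<close>, \<open>Q = 1\<close> witnesses the last clause of (ii):
    here \<open>Q\<close> lies below \<open>2 * (T - 1)\<close>, and both values already equal their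
    logarithms.\<close>
  have E21: "int (M_E 2 1) = 1" using E_lower(1)[of 2 1] E_upper[of 2 1] by simp
  have N21: "int (M_N 2 1) = 1" using N_lower(1)[of 2 1] N_upper(1)[of 2 1] by simp
  show ?thesis
  proof (intro conjI allI impI)
    fix T Q :: nat
    show "max (int T - int Q) \<lfloor>log 2 (real T + 1)\<rfloor> \<le> int (M_E T Q)" using E_lower by simp
    show "int (M_E T Q) \<le> max (int T - int Q) \<lceil>real T / 2\<rceil>"
      unfolding ceiling_half by (rule E_upper)
  next
    fix T :: nat assume "T \<ge> 1"
    then show "int (M_N T 0) = int T - 1" "int (M_N T 1) = int T - 1"
      using N_lower(1)[of T 0] N_lower(1)[of T 1] N_upper(1)[of T 0] N_upper(1)[of T 1] by auto
  next
    fix T Q :: nat assume "T \<ge> 1 \<and> Q \<ge> 1"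
    then show "max (int T - int Q) \<lfloor>log 2 (real T)\<rfloor> \<le> int (M_N T Q)"
      using N_lower[of T Q] by (simp add: max_def)
    show "int (M_N T Q) \<le> min (int T - 1) (max (int T - int Q) \<lceil>real T / 2\<rceil>)"
      unfolding ceiling_half using N_upper[of T Q] \<open>T \<ge> 1 \<and> Q \<ge> 1\<close> by simp
  next
    fix T Q :: nat assume "T \<ge> 1 \<and> int Q \<le> \<lfloor>real T / 2\<rfloor>"
    then have "Q \<le> T div 2" unfolding floor_half by simp
    \<comment> \<open>In this range \<open>T - Q\<close> is at least half of \<open>T\<close>
      rounded up, so the two bounds of (i) meet.\<close>
    then have "int ((T + 1) div 2) \<le> int T - int Q" by linarith
    with E_upper[of T Q] E_lower(1)[of T Q] show "int (M_E T Q) = int T - int Q" by simp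
  next
    show "\<exists>T Q :: nat. T \<ge> 1 \<and> int Q < 2 * (int T - 1) \<and>
         int (M_E T Q) = \<lfloor>log 2 (real T + 1)\<rfloor> \<and> int (M_N T Q) = \<lfloor>log 2 (real T)\<rfloor>"
      using E21 N21 logs by (intro exI[of _ 2] exI[of _ 1]) simp
  qed (use E_log N_log E53 N64 logs in auto)
qed

end
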